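(* Let $H(s)\in\mathcal{RH}_\infty^{n\times n}$, and let $$\Theta=\begin{bmatrix}\Theta_{11}&0&\Theta_{13}\\0&\Theta_{22}&0\\ \Theta_{13}&0&\Theta_{33}\end{bmatrix}$$ be a real symmetric matrix that is indefinite and satisfies $\Theta_{11}\ge\Theta_{22}$. Put $\alpha=\Theta_{11}-\Theta_{22}$ and $H_s(\omega)=\tfrac12\big(H(\mathrm{j}\omega)+H(\mathrm{j}\omega)^*\big)$. If for all $\omega\in\mathbb{R}$ $$Q(\omega):=\alpha H_s(\omega)^2+\Theta_{22}H(\mathrm{j}\omega)^*H(\mathrm{j}\omega)+2\Theta_{13}H_s(\omega)+\Theta_{33}I_n\preceq 0,$$ then $\mathrm{SG}(H)\subseteq\mathcal{C}(\Theta)$.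
   Context: $\mathcal{RH}_\infty^{n\times n}$ is the set of $n\times n$ real-rational, proper transfer matrices with all poles in the open left half-plane. Such an $H(s)$ is identified with the LTI operator $H:\mathcal{L}_2^n\to\mathcal{L}_2^n$ it defines (with zero initial condition), where $\mathcal{L}_2^n$ is the space of square-integrable signals $u:\mathbb{R}_{\ge 0}\to\mathbb{R}^n$ with inner product $\langle u,y\rangle=\int_0^\infty u(t)^\top y(t)\,dt$ and norm $\|u\|^2=\langle u,u\rangle$. For $u,y\in\mathcal{L}_2^n$, $u\ne0$, let $\rho(u,y)=\|y\|/\|u\|$ and $\theta(u,y)=\arccos\!\big(\langle u,y\rangle/(\|u\|\|y\|)\big)$, with $\theta(u,y)=0$ if $y=0$. The (soft) scaled graph is $\mathrm{SG}(H)=\{\rho(u,y)e^{\pm \mathrm{j}\theta(u,y)}: u\in\mathcal{L}_2^n\setminus\{0\},\ y=Hu\}\subset\mathbb{C}$. The conic region is $\mathcal{C}(\Theta)=\{z\in\mathbb{C}: v(z)^\top\Theta v(z)\le0\}$ with $v(z)=[\mathrm{Re}\{z\}\ \ \mathrm{Im}\{z\}\ \ 1]^\top$, i.e. the set of $z=x+\mathrm{j}y\in\mathbb{C}$ with $\Theta_{11}x^2+\Theta_{22}y^2+2\Theta_{13}x+\Theta_{33}\le0$. A real symmetric matrix is indefinite if it has at least one positive and at least one negative eigenvalue; $\preceq 0$ means Hermitian negative semidefinite. *)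

theory Defs
  imports
    "HOL-Analysis.Analysis"
    "HOL-Computational_Algebra.Computational_Algebra"
    "HOL-Computational_Algebra.Field_as_Ring"
begin

text \<open>
  A real-rational transfer matrix is a matrix over the field of fractions of \<open>real poly\<close>.
  \<open>quot_of_fract\<close> yields a representation in lowest terms, so the complex zeros of the
  denominator are exactly the poles of the entry.
\<close>

type_synonym 'n transfer_matrix = "real poly fract ^ 'n ^ 'n"

definition rat_num :: "real poly fract \<Rightarrow> real poly" where
  "rat_num r = fst (quot_of_fract r)"

definition rat_den :: "real poly fract \<Rightarrow> real poly" where
  "rat_den r = snd (quot_of_fract r)"

definition rat_poles :: "real poly fract \<Rightarrow> complex set" where
  "rat_poles r = {s. poly (map_poly complex_of_real (rat_den r)) s = 0}"

definition rat_eval :: "real poly fract \<Rightarrow> complex \<Rightarrow> complex" where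
  "rat_eval r s =
     poly (map_poly complex_of_real (rat_num r)) s / poly (map_poly complex_of_real (rat_den r)) s"

definition proper_rat :: "real poly fract \<Rightarrow> bool" where
  "proper_rat r \<longleftrightarrow> degree (rat_num r) \<le> degree (rat_den r)"

definition RH_inf :: "('n::finite) transfer_matrix set" where
  "RH_inf = {H. \<forall>i j. proper_rat (H $ i $ j) \<and> (\<forall>s \<in> rat_poles (H $ i $ j). Re s < 0)}"

definition tf_eval :: "('n::finite) transfer_matrix \<Rightarrow> complex \<Rightarrow> complex ^ 'n ^ 'n" where
  "tf_eval H s = (\<chi> i j. rat_eval (H $ i $ j) s)"


text \<open>
  Signals are functions on the whole real line of which only the values on \<open>{0..}\<close> matter.
  Elements of \<open>L2\<close> are representatives of the usual equivalence classes; hence being nonzero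
  is expressed below as having nonzero norm.
\<close>

definition L2 :: "(real \<Rightarrow> real ^ 'n::finite) set" where
  "L2 = {u. set_borel_measurable lborel {0..} u \<and>
            set_integrable lborel {0..} (\<lambda>t. (norm (u t))\<^sup>2)}"

definition l2_inner :: "(real \<Rightarrow> real ^ 'n::finite) \<Rightarrow> (real \<Rightarrow> real ^ 'n) \<Rightarrow> real" where
  "l2_inner u y = (LINT t:{0..}|lborel. u t \<bullet> y t)"

definition l2_norm :: "(real \<Rightarrow> real ^ 'n::finite) \<Rightarrow> real" where
  "l2_norm u = sqrt (l2_inner u u)"

definition laplace :: "(real \<Rightarrow> real ^ 'n::finite) \<Rightarrow> complex \<Rightarrow> complex ^ 'n" where
  "laplace u s =
     (\<chi> i. LINT t:{0..}|lborel. exp (- (s * complex_of_real t)) * complex_of_real (u t $ i))"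

text \<open>
  The graph of the operator on \<open>L2\<close> with transfer matrix \<open>H\<close> and zero initial condition:
  \<open>y = H u\<close> iff the Laplace transforms satisfy \<open>Y(s) = H(s) U(s)\<close> on the open right half-plane.
  The integral defining the Laplace transform of an \<open>L2\<close> signal converges absolutely there.  For
  \<open>H\<close> in \<open>RH_inf\<close> each \<open>u\<close> has exactly one such \<open>y\<close>, up to equality almost everywhere.
\<close>

definition lti_response ::
  "('n::finite) transfer_matrix \<Rightarrow> (real \<Rightarrow> real ^ 'n) \<Rightarrow> (real \<Rightarrow> real ^ 'n) \<Rightarrow> bool" where
  "lti_response H u y \<longleftrightarrow> u \<in> L2 \<and> y \<in> L2 \<and>
     (\<forall>s. Re s > 0 \<longrightarrow> laplace y s = tf_eval H s *v laplace u s)"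


definition gain :: "(real \<Rightarrow> real ^ 'n::finite) \<Rightarrow> (real \<Rightarrow> real ^ 'n) \<Rightarrow> real" where
  "gain u y = l2_norm y / l2_norm u"

definition phase :: "(real \<Rightarrow> real ^ 'n::finite) \<Rightarrow> (real \<Rightarrow> real ^ 'n) \<Rightarrow> real" where
  "phase u y =
     (if l2_norm y = 0 then 0 else arccos (l2_inner u y / (l2_norm u * l2_norm y)))"

definition scaled_graph :: "('n::finite) transfer_matrix \<Rightarrow> complex set" where
  "scaled_graph H = {z. \<exists>u y. u \<in> L2 \<and> l2_norm u \<noteq> 0 \<and> lti_response H u y \<and>
     (z = rcis (gain u y) (phase u y) \<or> z = rcis (gain u y) (- phase u y))}"


definition conic_region :: "real ^ 3 ^ 3 \<Rightarrow> complex set" where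
  "conic_region \<Theta> = {z. let v = vector [Re z, Im z, 1] in v \<bullet> (\<Theta> *v v) \<le> 0}"

definition eigenvalue_of :: "real ^ 'm ^ 'm::finite \<Rightarrow> real \<Rightarrow> bool" where
  "eigenvalue_of A \<mu> \<longleftrightarrow> (\<exists>x. x \<noteq> 0 \<and> A *v x = \<mu> *\<^sub>R x)"

definition indefinite :: "real ^ 'm ^ 'm::finite \<Rightarrow> bool" where
  "indefinite A \<longleftrightarrow> (\<exists>\<mu>. \<mu> > 0 \<and> eigenvalue_of A \<mu>) \<and> (\<exists>\<mu>. \<mu> < 0 \<and> eigenvalue_of A \<mu>)"

definition conj_transpose :: "complex ^ 'n ^ 'n::finite \<Rightarrow> complex ^ 'n ^ 'n" where
  "conj_transpose M = (\<chi> i j. cnj (M $ j $ i))"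

definition hermitian_part :: "complex ^ 'n ^ 'n::finite \<Rightarrow> complex ^ 'n ^ 'n" where
  "hermitian_part M = (1 / 2) *\<^sub>R (M + conj_transpose M)"

definition neg_semidef :: "complex ^ 'n ^ 'n::finite \<Rightarrow> bool" where
  "neg_semidef M \<longleftrightarrow> conj_transpose M = M \<and>
     (\<forall>x. Re (\<Sum>i\<in>UNIV. cnj (x $ i) * (M *v x) $ i) \<le> 0)"

end

theory Submission
  imports Defs "HOL-Probability.Characteristic_Functions"
begin

text \<open>
  With \<open>p = \<langle>u, y\<rangle>\<close>, membership of the scaled graph points in the conic region means
  \<open>\<alpha> p\<^sup>2 / |u|\<^sup>2 + \<Theta>\<^sub>2\<^sub>2 |y|\<^sup>2 + 2 \<Theta>\<^sub>1\<^sub>3 p + \<Theta>\<^sub>3\<^sub>3 |u|\<^sup>2 \<le> 0\<close>.  For every real \<open>c\<close> one has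
  \<open>|H\<^sub>s x|\<^sup>2 \<ge> 2 c (x \<bullet> H x) - c\<^sup>2 |x|\<^sup>2\<close>, so \<open>Q(\<omega>) \<preceq> 0\<close> gives a pointwise inequality between \<open>x \<bullet> H x\<close>,
  \<open>|H x|\<^sup>2\<close> and \<open>|x|\<^sup>2\<close>.  Parseval turns it into
  \<open>(2 \<alpha> c + 2 \<Theta>\<^sub>1\<^sub>3) p + \<Theta>\<^sub>2\<^sub>2 |y|\<^sup>2 + (\<Theta>\<^sub>3\<^sub>3 - \<alpha> c\<^sup>2) |u|\<^sup>2 \<le> 0\<close>, and \<open>c = p / |u|\<^sup>2\<close> is the wanted one.

  Boundary values of Laplace transforms on the imaginary axis are avoided by working on the line
  \<open>Re s = \<sigma> > 0\<close>, where \<open>e\<^sup>-\<^sup>\<sigma>\<^sup>t u(t)\<close> is integrable and square integrable.  Stable proper rational functions are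
  Lipschitz on the closed right half-plane, so the inequality holds on that line up to an error
  \<open>O(\<sigma>) |U|\<^sup>2\<close>, which vanishes as \<open>\<sigma> \<rightarrow> 0\<close>.
\<close>

subsection \<open>Stable proper rational functions\<close>

text \<open>Induction on the degree of \<open>q\<close>: split off a root \<open>a\<close> of
  \<open>q\<close> and divide \<open>p\<close> by the same linear factor. The quotient is controlled
  by the induction hypothesis, the constant remainder by the distance from \<open>a\<close> to the
  half-plane. The product form avoids dividing by \<open>poly q s\<close>.\<close>

lemma bounded_ratio_right_half_plane:
  fixes p q :: "complex poly"
  assumes "degree p \<le> degree q" "q \<noteq> 0" "\<And>z. poly q z = 0 \<Longrightarrow> Re z < 0"
  shows "\<exists>C. \<forall>s. Re s \<ge> 0 \<longrightarrow> norm (poly p s) \<le> C * norm (poly q s)"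
  using assms
proof (induction "degree q" arbitrary: p q)
  case 0
  then obtain a b where "p = [:a:]" "q = [:b:]"
    by (metis degree_eq_zeroE le_zero_eq)
  with 0 show ?case
    by (intro exI[of _ "norm a / norm b"]) auto
next
  case (Suc n)
  then have "\<not> constant (poly q)"
    by (simp add: constant_degree)
  then obtain a where a: "poly q a = 0"
    using fundamental_theorem_of_algebra by blast
  then obtain q' where q: "q = [:-a, 1:] * q'"
    using poly_eq_0_iff_dvd by (metis dvdE)
  have "q' \<noteq> 0" using Suc.prems q by auto
  then have deg: "n = degree q'"
    using Suc.hyps(2) unfolding q by (simp add: degree_mult_eq del: mult_pCons_left)
  have roots: "Re z < 0" if "poly q' z = 0" for z
    using Suc.prems(3)[of z] that by (simp add: q)
  have "Re a < 0" using Suc.prems a by blast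
  obtain p' where p: "p = [:-a, 1:] * p' + [:poly p a:]"
    using synthetic_div_correct'[of a p] by metis
  have "degree p' \<le> n"
  proof (cases "p' = 0")
    case False
    have "degree ([:-a, 1:] * p') = degree (p - [:poly p a:])" using p by (metis add_diff_cancel_right')
    also have "\<dots> \<le> Suc n"
      using Suc.prems(1) Suc.hyps(2) by (intro degree_diff_le) auto
    finally show ?thesis using False by (simp add: degree_mult_eq del: mult_pCons_left)
  qed simp
  obtain C1 where C1: "\<And>s. Re s \<ge> 0 \<Longrightarrow> norm (poly p' s) \<le> C1 * norm (poly q' s)"
    using Suc.hyps(1)[OF deg _ \<open>q' \<noteq> 0\<close> roots, of p'] \<open>degree p' \<le> n\<close> deg by blast
  \<comment> \<open>The induction hypothesis for the constant polynomial 1 bounds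
    \<open>poly q'\<close> away from 0, which is what the remainder \<open>poly p a\<close>
    needs.\<close>
  obtain C2 where C2: "\<And>s. Re s \<ge> 0 \<Longrightarrow> 1 \<le> C2 * norm (poly q' s)"
    using Suc.hyps(1)[OF deg _ \<open>q' \<noteq> 0\<close> roots, of 1] by auto
  show ?case
  proof (intro exI allI impI)
    fix s :: complex assume s: "Re s \<ge> 0"
    have "Re (s - a) \<le> norm (s - a)" by (rule complex_Re_le_cmod)
    \<comment> \<open>Every point of the closed right half-plane has distance at least
      \<open>- Re a > 0\<close> from the root.\<close>
    then have r: "- Re a \<le> norm (s - a)" using s by simp
    have "poly q s = (s - a) * poly q' s" by (simp add: q algebra_simps)
    then have nq: "norm (poly q s) = norm (s - a) * norm (poly q' s)" by (simp only: norm_mult)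
    have "1 \<le> C2 * norm (poly q' s)" by (rule C2[OF s])
    then have "-Re a * 1 \<le> norm (s - a) * (C2 * norm (poly q' s))"
      using \<open>Re a < 0\<close> r by (intro mult_mono) auto
    then have "1 \<le> C2 / (- Re a) * norm (poly q s)"
      using \<open>Re a < 0\<close> by (simp add: nq field_simps)
    from mult_left_mono[OF this, of "norm (poly p a)"]
    have 1: "norm (poly p a) \<le> norm (poly p a) * (C2 / (- Re a)) * norm (poly q s)"
      by (simp add: mult.assoc)
    have "norm (s - a) * norm (poly p' s) \<le> norm (s - a) * (C1 * norm (poly q' s))"
      by (intro mult_left_mono C1 s) auto
    also have "\<dots> = C1 * norm (poly q s)" by (simp add: nq)
    finally have 2: "norm (s - a) * norm (poly p' s) \<le> C1 * norm (poly q s)" .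
    have "poly p s = (s - a) * poly p' s + poly p a"
      by (subst p) (simp add: algebra_simps)
    then have "norm (poly p s) \<le> norm (s - a) * norm (poly p' s) + norm (poly p a)"
      by (metis norm_mult norm_triangle_ineq)
    with 1 2 show "norm (poly p s) \<le> (C1 + norm (poly p a) * (C2 / (- Re a))) * norm (poly q s)"
      unfolding distrib_right by linarith
  qed
qed

text \<open>For the Lipschitz bound, the derivative (p' q - p q') / q^2 is again proper with poles
  only in the open left half-plane, hence bounded. The mean value inequality applies because the
  closed half-plane is convex.\<close>

lemma bounded_stable_rat:
  assumes "proper_rat r" "\<forall>s\<in>rat_poles r. Re s < 0"
  shows "\<exists>C. \<forall>s. Re s \<ge> 0 \<longrightarrow> norm (rat_eval r s) \<le> C"
    and "\<exists>L. \<forall>s t. Re s \<ge> 0 \<longrightarrow> Re t \<ge> 0 \<longrightarrow> norm (rat_eval r s - rat_eval r t) \<le> L * norm (s - t)"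
proof -
  define p where "p = map_poly complex_of_real (rat_num r)"
  define q where "q = map_poly complex_of_real (rat_den r)"
  have "rat_den r \<noteq> 0" by (simp add: rat_den_def)
  then have q0: "q \<noteq> 0" unfolding q_def by (metis map_poly_eq_0_iff of_real_0 of_real_eq_0_iff)
  have deg: "degree p \<le> degree q"
    using assms(1) by (simp add: p_def q_def proper_rat_def degree_map_poly)
  have qz: "Re z < 0" if "poly q z = 0" for z
    using assms(2) that by (auto simp: rat_poles_def q_def)
  then have qnz: "poly q z \<noteq> 0" if "Re z \<ge> 0" for z using that by force
  have ev: "rat_eval r = (\<lambda>s. poly p s / poly q s)"
    by (simp add: fun_eq_iff rat_eval_def p_def q_def)
  obtain C where "\<And>s. Re s \<ge> 0 \<Longrightarrow> norm (poly p s) \<le> C * norm (poly q s)"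
    using bounded_ratio_right_half_plane[OF deg q0 qz] by blast
  then have "\<forall>s. Re s \<ge> 0 \<longrightarrow> norm (rat_eval r s) \<le> C"
    using qnz by (auto simp: ev norm_divide divide_le_eq)
  then show "\<exists>C. \<forall>s. Re s \<ge> 0 \<longrightarrow> norm (rat_eval r s) \<le> C" ..
  define w where "w = pderiv p * q - p * pderiv q"
  have "degree w \<le> degree (q * q)"
    unfolding w_def using deg q0
    by (intro degree_diff_le order.trans[OF degree_mult_le]) (auto simp: degree_pderiv degree_mult_eq)
  moreover have "q * q \<noteq> 0" using q0 by simp
  moreover have "Re z < 0" if "poly (q * q) z = 0" for z using that qz by auto
  ultimately obtain L where L: "\<And>s. Re s \<ge> 0 \<Longrightarrow> norm (poly w s) \<le> L * norm (poly (q * q) s)"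
    using bounded_ratio_right_half_plane by blast
  have "norm (rat_eval r s - rat_eval r t) \<le> L * norm (s - t)" if "Re s \<ge> 0" "Re t \<ge> 0" for s t
  proof (rule field_differentiable_bound[where S = "{z. 0 \<le> Re z}"])
    show "convex {z. 0 \<le> Re z}" by (rule convex_halfspace_Re_ge)
    show "(rat_eval r has_field_derivative poly w z / poly (q * q) z) (at z within {z. 0 \<le> Re z})"
      if "z \<in> {z. 0 \<le> Re z}" for z
      unfolding ev using qnz[of z] that
      by (auto intro!: derivative_eq_intros simp: w_def)
    show "norm (poly w z / poly (q * q) z) \<le> L" if "z \<in> {z. 0 \<le> Re z}" for z
      using L[of z] qnz[of z] that by (simp add: norm_divide divide_le_eq)
  qed (use that in auto)
  then show "\<exists>L. \<forall>s t. Re s \<ge> 0 \<longrightarrow> Re t \<ge> 0 \<longrightarrow> norm (rat_eval r s - rat_eval r t) \<le> L * norm (s - t)"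
    by blast
qed

subsection \<open>Translations in the space of square integrable functions\<close>

lemma power2_add_le: "(a + b)\<^sup>2 \<le> 2 * a\<^sup>2 + 2 * b\<^sup>2" for a b :: real
  using zero_le_power2[of "a - b"] by (simp add: power2_eq_square algebra_simps)

lemma power2_le_iff_abs: "\<bar>a\<bar> \<le> \<bar>b\<bar> \<Longrightarrow> a\<^sup>2 \<le> b\<^sup>2" for a b :: real
  by (simp add: abs_le_square_iff)

lemma abs_mult_le_sum_squares: "\<bar>a * b\<bar> \<le> a\<^sup>2 + b\<^sup>2" for a b :: real
  using sum_squares_bound[of "\<bar>a\<bar>" "\<bar>b\<bar>"] abs_ge_zero[of "a * b"]
  unfolding abs_mult power2_abs by linarith

lemma power2_diff_le: "\<bar>(a - b)\<^sup>2\<bar> \<le> (2 * B)\<^sup>2" if "\<bar>a\<bar> \<le> B" "\<bar>b\<bar> \<le> B" for a b B :: real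
  using that by (simp only: abs_power2, intro power2_le_iff_abs) linarith

lemma integrable_bounded_interval:
  fixes g :: "real \<Rightarrow> real"
  assumes "g \<in> borel_measurable borel" "\<And>t. \<bar>g t\<bar> \<le> B" "\<And>t. \<bar>t\<bar> > K \<Longrightarrow> g t = 0"
  shows "integrable lborel g"
proof (rule Bochner_Integration.integrable_bound[where f = "\<lambda>t. B * indicator {-K..K} t"])
  show "integrable lborel (\<lambda>t. B * indicator {-K..K} t :: real)"
    by (intro integrable_mult_right integrable_real_indicator) (auto simp: emeasure_lborel_Icc_eq)
  have "\<bar>g t\<bar> \<le> B * indicator {-K..K} t" for t
    using assms(2)[of t] assms(3)[of t] by (cases "\<bar>t\<bar> > K") (auto simp: indicator_def abs_le_iff)
  then show "AE t in lborel. norm (g t) \<le> norm (B * indicator {-K..K} t :: real)"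
    by (auto intro: order.trans[OF _ abs_ge_self])
qed (use assms in auto)

text \<open>Density of compactly supported continuous functions in L2. Measurability gives
  continuous functions converging to \<open>f\<close> almost everywhere but without any bound;
  clamping the values and cutting off the domain supplies the domination needed to pass to the limit
  in the integral.\<close>

lemma square_integrable_approx_continuous:
  fixes f :: "real \<Rightarrow> real"
  assumes f [measurable]: "f \<in> borel_measurable borel"
    and f2: "integrable lborel (\<lambda>t. (f t)\<^sup>2)" and "e > 0"
  obtains g K where "continuous_on UNIV g" "\<And>t. \<bar>t\<bar> > K \<Longrightarrow> g t = 0"
    "integrable lborel (\<lambda>t. (f t - g t)\<^sup>2)" "(LINT t|lborel. (f t - g t)\<^sup>2) < e"
proof -
  have "f measurable_on UNIV"
    by (rule lebesgue_measurable_imp_measurable_on) (use f in \<open>auto intro: measurable_completion\<close>)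
  then obtain N g where N: "negligible N" and cont: "\<And>n. continuous_on UNIV (g n)"
    and lim: "\<And>x. x \<notin> N \<Longrightarrow> (\<lambda>n. g n x) \<longlonglongrightarrow> f x"
    by (auto simp: measurable_on_def)
  have AEN: "AE x in lborel. x \<notin> N"
  proof -
    have "AE x in lebesgue. x \<notin> N"
      using N by (intro AE_not_in) (simp add: negligible_iff_null_sets)
    then show ?thesis by (simp only: AE_completion_iff)
  qed
  \<comment> \<open>\<open>T k\<close> clamps values to [-k, k]. \<open>\<phi> k\<close> is a
    continuous cutoff, equal to 1 on [-k, k] and 0 outside [-k-1, k+1].\<close>
  define T where "T = (\<lambda>k x. max (- real k) (min (real k) x))"
  define \<phi> where "\<phi> = (\<lambda>k t. max 0 (min 1 (real k + 1 - \<bar>t\<bar>)))"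
  have T_cont: "continuous_on UNIV (T k)" and \<phi>_cont: "continuous_on UNIV (\<phi> k)" for k
    unfolding T_def \<phi>_def by (intro continuous_intros)+
  have [measurable]: "T k \<in> borel_measurable borel" "\<phi> k \<in> borel_measurable borel"
    "g k \<in> borel_measurable borel" for k
    using T_cont \<phi>_cont cont by (auto intro: borel_measurable_continuous_onI)
  have \<phi>01: "0 \<le> \<phi> k t" "\<phi> k t \<le> 1" for k t by (auto simp: \<phi>_def)
  have \<phi>0: "\<phi> k t = 0" if "\<bar>t\<bar> > real k + 1" for k t using that by (auto simp: \<phi>_def)
  have Tb: "\<bar>T k x\<bar> \<le> real k" for k x by (auto simp: T_def)
  have T\<phi>: "\<bar>T k x * \<phi> k t\<bar> \<le> real k" for k x t
    using mult_mono[OF Tb[of k x] \<phi>01(2)[of k t]] \<phi>01(1)[of k t] by (simp add: abs_mult)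
  \<comment> \<open>The truncated value lies between 0 and \<open>x\<close>, so the truncation error
    is dominated by \<open>f\<close> itself.\<close>
  have cut: "\<bar>x - T k x * \<phi> k t\<bar> \<le> \<bar>x\<bar>" for k x t
  proof -
    have "0 \<le> T k x * \<phi> k t \<and> T k x * \<phi> k t \<le> x" if "x \<ge> 0"
    proof -
      have "0 \<le> T k x" "T k x \<le> x" using that by (auto simp: T_def)
      then show ?thesis using \<phi>01[of k t] by (meson mult_left_le mult_nonneg_nonneg order_trans)
    qed
    moreover have "0 \<le> (- T k x) * \<phi> k t \<and> (- T k x) * \<phi> k t \<le> - x" if "x \<le> 0"
    proof -
      have "0 \<le> - T k x" "- T k x \<le> - x" using that by (auto simp: T_def)
      then show ?thesis using \<phi>01[of k t] by (meson mult_left_le mult_nonneg_nonneg order_trans)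
    qed
    ultimately show ?thesis by (cases "x \<ge> 0") auto
  qed
  have I1: "integrable lborel (\<lambda>t. (f t - T k (f t) * \<phi> k t)\<^sup>2)" for k
    by (rule Bochner_Integration.integrable_bound[OF f2]) (auto simp: cut abs_le_square_iff[symmetric])
  have "(\<lambda>k. LINT t|lborel. (f t - T k (f t) * \<phi> k t)\<^sup>2) \<longlonglongrightarrow> (LINT t|(lborel :: real measure). (0::real))"
  proof (rule integral_dominated_convergence)
    show "integrable lborel (\<lambda>t. (f t)\<^sup>2)" by (rule f2)
    show "AE t in lborel. (\<lambda>k. (f t - T k (f t) * \<phi> k t)\<^sup>2) \<longlonglongrightarrow> 0"
    proof (intro AE_I2 tendsto_eventually)
      fix t
      obtain k0 :: nat where k0: "max \<bar>f t\<bar> \<bar>t\<bar> \<le> real k0" using real_arch_simple by blast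
      show "\<forall>\<^sub>F k in sequentially. (f t - T k (f t) * \<phi> k t)\<^sup>2 = 0"
        using eventually_ge_at_top[of k0]
      proof eventually_elim
        case (elim k)
        then have "real k0 \<le> real k" by simp
        then have "T k (f t) = f t" "\<phi> k t = 1" using k0 by (auto simp: T_def \<phi>_def)
        then show ?case by simp
      qed
    qed
  qed (auto simp: cut abs_le_square_iff[symmetric])
  \<comment> \<open>Two errors below e/4 suffice, since the square of their sum costs a factor 2 on
    each. First \<open>k\<close> is fixed, then \<open>n\<close> is chosen for that
    \<open>k\<close>.\<close>
  then have "\<forall>\<^sub>F k in sequentially. (LINT t|lborel. (f t - T k (f t) * \<phi> k t)\<^sup>2) < e / 4"
    using \<open>e > 0\<close> by (intro order_tendstoD) auto
  then obtain k where k: "(LINT t|lborel. (f t - T k (f t) * \<phi> k t)\<^sup>2) < e / 4"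
    by (auto dest: eventually_happens)
  let ?d = "\<lambda>n t. (T k (f t) * \<phi> k t - T k (g n t) * \<phi> k t)\<^sup>2"
  have dB: "\<bar>?d n t\<bar> \<le> (2 * real k)\<^sup>2" for n t
    by (intro power2_diff_le T\<phi>)
  have I2: "integrable lborel (?d n)" for n
    by (rule integrable_bounded_interval[OF _ dB, where K = "real k + 1"]) (auto simp: \<phi>0)
  have "(\<lambda>n. LINT t|lborel. ?d n t) \<longlonglongrightarrow> (LINT t|(lborel :: real measure). (0::real))"
  proof (rule integral_dominated_convergence)
    show "integrable lborel (\<lambda>t. (2 * real k)\<^sup>2 * indicator {-(real k + 1)..real k + 1} t :: real)"
      by (intro integrable_mult_right integrable_real_indicator) (auto simp: emeasure_lborel_Icc_eq)
    show "AE t in lborel. norm (?d n t) \<le> (2 * real k)\<^sup>2 * indicator {-(real k + 1)..real k + 1} t" for n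
    proof (rule AE_I2)
      fix t show "norm (?d n t) \<le> (2 * real k)\<^sup>2 * indicator {-(real k + 1)..real k + 1} t"
        using dB[of t n] \<phi>0[of k t] by (cases "\<bar>t\<bar> > real k + 1") (auto simp: indicator_def abs_le_iff)
    qed
    show "AE t in lborel. (\<lambda>n. ?d n t) \<longlonglongrightarrow> 0"
      using AEN
    proof eventually_elim
      case (elim t)
      have "(\<lambda>n. T k (g n t)) \<longlonglongrightarrow> T k (f t)"
        unfolding T_def by (intro tendsto_intros lim elim)
      then have "(\<lambda>n. ?d n t) \<longlonglongrightarrow> (T k (f t) * \<phi> k t - T k (f t) * \<phi> k t)\<^sup>2"
        by (intro tendsto_intros)
      then show ?case by simp
    qed
  qed auto
  then have "\<forall>\<^sub>F n in sequentially. (LINT t|lborel. ?d n t) < e / 4"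
    using \<open>e > 0\<close> by (intro order_tendstoD) auto
  then obtain n where n: "(LINT t|lborel. ?d n t) < e / 4"
    by (auto dest: eventually_happens)
  define h where "h = (\<lambda>t. T k (g n t) * \<phi> k t)"
  have split: "(f t - h t)\<^sup>2 \<le> 2 * (f t - T k (f t) * \<phi> k t)\<^sup>2 + 2 * ?d n t" for t
    using power2_add_le[of "f t - T k (f t) * \<phi> k t" "T k (f t) * \<phi> k t - h t"] by (simp add: h_def)
  have I: "integrable lborel (\<lambda>t. 2 * (f t - T k (f t) * \<phi> k t)\<^sup>2 + 2 * ?d n t)"
    by (intro Bochner_Integration.integrable_add integrable_mult_right I1 I2)
  have I': "integrable lborel (\<lambda>t. (f t - h t)\<^sup>2)"
    by (rule Bochner_Integration.integrable_bound[OF I]) (auto simp: h_def[symmetric] split intro: order.trans[OF _ abs_ge_self], simp add: h_def)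
  have "(LINT t|lborel. (f t - h t)\<^sup>2) \<le> (LINT t|lborel. 2 * (f t - T k (f t) * \<phi> k t)\<^sup>2 + 2 * ?d n t)"
    by (intro integral_mono I I' split)
  also have "\<dots> = 2 * (LINT t|lborel. (f t - T k (f t) * \<phi> k t)\<^sup>2) + 2 * (LINT t|lborel. ?d n t)"
    using I1[of k] I2[of n] by simp
  also have "\<dots> < e" using k n by simp
  finally have "(LINT t|lborel. (f t - h t)\<^sup>2) < e" .
  moreover have "continuous_on UNIV h"
    unfolding h_def using T_cont cont \<phi>_cont
    by (intro continuous_intros continuous_on_compose2[OF T_cont[of k]]) auto
  ultimately show ?thesis
    using that[of h "real k + 1"] I' \<phi>0[of k] by (simp add: h_def)
qed

text \<open>Approximate \<open>f\<close> by a compactly supported continuous \<open>g\<close>.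
  Translation invariance makes the two terms with f - g equally small, and dominated convergence
  treats the shift of \<open>g\<close>.\<close>

lemma l2_translation_continuous:
  fixes f :: "real \<Rightarrow> real"
  assumes f [measurable]: "f \<in> borel_measurable borel"
    and f2: "integrable lborel (\<lambda>t. (f t)\<^sup>2)" and X: "X \<longlonglongrightarrow> 0"
  shows "(\<lambda>n. LINT t|lborel. (f (t + X n) - f t)\<^sup>2) \<longlonglongrightarrow> 0"
proof (rule order_tendstoI)
  fix e :: real assume "0 < e"
  \<comment> \<open>The three errors enter below with weights 4, 4 and 2, and 10/12 is less than
    1.\<close>
  then have "e / 12 > 0" by simp
  then obtain g K where g: "continuous_on UNIV g" "\<And>t. \<bar>t\<bar> > K \<Longrightarrow> g t = 0"
    and I: "integrable lborel (\<lambda>t. (f t - g t)\<^sup>2)" and e: "(LINT t|lborel. (f t - g t)\<^sup>2) < e / 12"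
    by (rule square_integrable_approx_continuous[OF f f2]) blast
  have [measurable]: "g \<in> borel_measurable borel"
    using g(1) by (rule borel_measurable_continuous_onI)
  have "bounded (g ` {-K..K})"
    by (intro compact_imp_bounded compact_continuous_image continuous_on_subset[OF g(1)]) auto
  then obtain B0 where B0: "\<forall>t\<in>{-K..K}. \<bar>g t\<bar> \<le> B0" by (auto simp: bounded_iff)
  define B where "B = max 0 B0"
  have B: "\<bar>g t\<bar> \<le> B" for t
  proof (cases "t \<in> {-K..K}")
    case True
    then have "\<bar>g t\<bar> \<le> B0" using B0 by blast
    then show ?thesis by (simp add: B_def)
  next
    case False
    then have "\<bar>t\<bar> > K" by auto
    then show ?thesis using g(2) by (simp add: B_def)
  qed
  \<comment> \<open>A common bound for all shifts confines every difference to the fixed interval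
    [-K-R, K+R], giving one dominating function.\<close>
  obtain R where R: "\<And>n. \<bar>X n\<bar> \<le> R"
    using convergent_imp_Bseq[OF convergentI[OF X]] by (auto simp: Bseq_def)
  let ?d = "\<lambda>n t. (g (t + X n) - g t)\<^sup>2"
  have dB: "\<bar>?d n t\<bar> \<le> (2 * B)\<^sup>2" for n t
    by (intro power2_diff_le B)
  have d0: "?d n t = 0" if "\<bar>t\<bar> > K + R" for n t
  proof -
    have "\<bar>t + X n\<bar> > K" "\<bar>t\<bar> > K" using that R[of n] by linarith+
    then show ?thesis using g(2) by simp
  qed
  have Id: "integrable lborel (?d n)" for n
    by (rule integrable_bounded_interval[OF _ dB d0]) auto
  have "(\<lambda>n. LINT t|lborel. ?d n t) \<longlonglongrightarrow> (LINT t|(lborel :: real measure). (0::real))"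
  proof (rule integral_dominated_convergence)
    show "integrable lborel (\<lambda>t. (2 * B)\<^sup>2 * indicator {-(K + R)..K + R} t :: real)"
      by (intro integrable_mult_right integrable_real_indicator) (auto simp: emeasure_lborel_Icc_eq)
    show "AE t in lborel. norm (?d n t) \<le> (2 * B)\<^sup>2 * indicator {-(K + R)..K + R} t" for n
    proof (rule AE_I2)
      fix t show "norm (?d n t) \<le> (2 * B)\<^sup>2 * indicator {-(K + R)..K + R} t"
        using dB[of t n] d0[of t n] by (cases "\<bar>t\<bar> > K + R") (auto simp: indicator_def abs_le_iff)
    qed
    show "AE t in lborel. (\<lambda>n. ?d n t) \<longlonglongrightarrow> 0"
    proof (rule AE_I2)
      fix t
      have tX: "(\<lambda>n. t + X n) \<longlonglongrightarrow> t" using tendsto_add[OF tendsto_const X, of t] by simp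
      have "isCont g t" using g(1) by (simp add: continuous_on_eq_continuous_at)
      then have "(\<lambda>n. g (t + X n)) \<longlonglongrightarrow> g t" by (rule isCont_tendsto_compose[OF _ tX])
      then have "(\<lambda>n. ?d n t) \<longlonglongrightarrow> (g t - g t)\<^sup>2" by (intro tendsto_intros)
      then show "(\<lambda>n. ?d n t) \<longlonglongrightarrow> 0" by simp
    qed
  qed auto
  then have "\<forall>\<^sub>F n in sequentially. (LINT t|lborel. ?d n t) < e / 12"
    using \<open>e > 0\<close> by (intro order_tendstoD) auto
  then show "\<forall>\<^sub>F n in sequentially. (LINT t|lborel. (f (t + X n) - f t)\<^sup>2) < e"
  proof eventually_elim
    case (elim n)
    let ?h = "\<lambda>t. (f t - g t)\<^sup>2"
    have I': "integrable lborel (\<lambda>t. ?h (t + X n))" and E': "(LINT t|lborel. ?h (t + X n)) = (LINT t|lborel. ?h t)"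
      using lborel_integrable_real_affine[OF I, of 1 "X n"] lborel_integral_real_affine[of 1 ?h "X n"]
      by (simp_all add: add.commute)
    let ?r = "\<lambda>t. 4 * ?h (t + X n) + 4 * ?d n t + 2 * ?h t"
    have Ir: "integrable lborel ?r" by (intro Bochner_Integration.integrable_add integrable_mult_right I' I Id)
    have le: "(f (t + X n) - f t)\<^sup>2 \<le> ?r t" for t
    proof -
      have "(f (t + X n) - f t)\<^sup>2 \<le> 2 * (f (t + X n) - g t)\<^sup>2 + 2 * (g t - f t)\<^sup>2"
        using power2_add_le[of "f (t + X n) - g t" "g t - f t"] by simp
      moreover have "(f (t + X n) - g t)\<^sup>2 \<le> 2 * ?h (t + X n) + 2 * ?d n t"
        using power2_add_le[of "f (t + X n) - g (t + X n)" "g (t + X n) - g t"] by simp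
      ultimately show ?thesis by (simp add: power2_commute[of "g t" "f t"])
    qed
    have "(LINT t|lborel. (f (t + X n) - f t)\<^sup>2) \<le> integral\<^sup>L lborel ?r"
      by (intro integral_mono Ir le Bochner_Integration.integrable_bound[OF Ir])
         (use le in \<open>auto intro: order.trans[OF _ abs_ge_self]\<close>)
    also have "\<dots> = 4 * (LINT t|lborel. ?h (t + X n)) + 4 * (LINT t|lborel. ?d n t) + 2 * (LINT t|lborel. ?h t)"
      using I' I Id[of n] by simp
    also have "\<dots> < e" using e elim E' \<open>0 < e\<close> by simp
    finally show ?case .
  qed
next
  fix e :: real assume "e < 0"
  then show "\<forall>\<^sub>F n in sequentially. e < (LINT t|lborel. (f (t + X n) - f t)\<^sup>2)"
    by (intro always_eventually allI less_le_trans[OF _ Bochner_Integration.integral_nonneg]) auto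
qed

text \<open>The bound is the inequality between geometric and arithmetic mean together with
  translation invariance. The limit follows from polarisation: the autocorrelation at
  \<open>r\<close> is the integral of f^2 minus half the squared L2 distance between
  \<open>f\<close> and its translate.\<close>

lemma autocorrelation:
  fixes f :: "real \<Rightarrow> real"
  assumes f [measurable]: "f \<in> borel_measurable borel"
    and f2: "integrable lborel (\<lambda>t. (f t)\<^sup>2)"
  shows autocorrelation_integrable: "integrable lborel (\<lambda>t. f t * f (t + r))"
    and autocorrelation_abs_le: "(LINT t|lborel. \<bar>f t * f (t + r)\<bar>) \<le> (LINT t|lborel. (f t)\<^sup>2)"
    and autocorrelation_tendsto: "X \<longlonglongrightarrow> 0 \<Longrightarrow>
      (\<lambda>n. LINT t|lborel. f t * f (t + X n)) \<longlonglongrightarrow> (LINT t|lborel. (f t)\<^sup>2)"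
proof -
  have I: "integrable lborel (\<lambda>t. (f (t + r))\<^sup>2)" and E: "(LINT t|lborel. (f (t + r))\<^sup>2) = (LINT t|lborel. (f t)\<^sup>2)" for r
    using lborel_integrable_real_affine[OF f2, of 1 r] lborel_integral_real_affine[of 1 "\<lambda>t. (f t)\<^sup>2" r]
    by (simp_all add: add.commute)
  have Is: "integrable lborel (\<lambda>t. ((f t)\<^sup>2 + (f (t + r))\<^sup>2) / 2)" for r
    by (intro integrable_divide Bochner_Integration.integrable_add f2 I)
  have le: "\<bar>f t * f (t + r)\<bar> \<le> ((f t)\<^sup>2 + (f (t + r))\<^sup>2) / 2" for t r
    using zero_le_power2[of "\<bar>f t\<bar> - \<bar>f (t + r)\<bar>"]
    by (simp add: power2_diff abs_mult)
  show Ic: "integrable lborel (\<lambda>t. f t * f (t + r))" for r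
    by (rule Bochner_Integration.integrable_bound[OF Is[of r]]) (use le[of _ r] in \<open>auto intro: order.trans\<close>)
  have "(LINT t|lborel. \<bar>f t * f (t + r)\<bar>) \<le> (LINT t|lborel. ((f t)\<^sup>2 + (f (t + r))\<^sup>2) / 2)"
    by (intro integral_mono le Is integrable_abs Ic)
  also have "\<dots> = (LINT t|lborel. (f t)\<^sup>2)" using f2 I[of r] by (simp add: E)
  finally show "(LINT t|lborel. \<bar>f t * f (t + r)\<bar>) \<le> (LINT t|lborel. (f t)\<^sup>2)" .
  have "(LINT t|lborel. (f (t + r) - f t)\<^sup>2) = 2 * (LINT t|lborel. (f t)\<^sup>2) - 2 * (LINT t|lborel. f t * f (t + r))" for r
  proof -
    have "(LINT t|lborel. (f (t + r) - f t)\<^sup>2) = (LINT t|lborel. (f (t + r))\<^sup>2 + (f t)\<^sup>2 - 2 * (f t * f (t + r)))"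
      by (simp add: power2_diff algebra_simps)
    also have "\<dots> = 2 * (LINT t|lborel. (f t)\<^sup>2) - 2 * (LINT t|lborel. f t * f (t + r))"
      using I[of r] f2 Ic[of r] by (simp add: E)
    finally show ?thesis .
  qed
  then have eq: "(LINT t|lborel. f t * f (t + r)) = (LINT t|lborel. (f t)\<^sup>2) - (LINT t|lborel. (f (t + r) - f t)\<^sup>2) / 2" for r
    by simp
  show "(\<lambda>n. LINT t|lborel. f t * f (t + X n)) \<longlonglongrightarrow> (LINT t|lborel. (f t)\<^sup>2)" if "X \<longlonglongrightarrow> 0"
  proof -
    have "(\<lambda>n. (LINT t|lborel. (f t)\<^sup>2) - (LINT t|lborel. (f (t + X n) - f t)\<^sup>2) / 2) \<longlonglongrightarrow> (LINT t|lborel. (f t)\<^sup>2) - 0 / 2"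
      by (intro tendsto_intros l2_translation_continuous f f2 that) simp
    then show ?thesis by (simp add: eq)
  qed
qed

subsection \<open>Plancherel and Parseval on the real line\<close>

text \<open>The unnormalised transform in angular frequency. It matches the Laplace transform on
  vertical lines, and it is the source of the factor 2 pi in Plancherel's identity.\<close>

definition fourier :: "(real \<Rightarrow> real) \<Rightarrow> real \<Rightarrow> complex" where
  "fourier f \<omega> = (LINT t|lborel. complex_of_real (f t) * iexp (- (\<omega> * t)))"

section \<open>Gaussian integrals and their Fourier transforms\<close>

lemma gaussian_eq: "exp (- x\<^sup>2 / 2) = sqrt (2 * pi) * std_normal_density x"
  by (simp add: std_normal_density_def)

lemma integrable_gaussian: "integrable lborel (\<lambda>x::real. exp (- x\<^sup>2 / 2))"
  unfolding gaussian_eq by auto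

lemma integral_gaussian: "(LINT x|lborel. exp (- x\<^sup>2 / 2)) = sqrt (2 * pi)"
  unfolding gaussian_eq by (subst integral_mult_right_zero) simp

text \<open>Up to the factor sqrt(2 pi) this is the characteristic function of the standard normal
  distribution.\<close>

lemma fourier_gaussian:
  "(LINT x|lborel. complex_of_real (exp (- x\<^sup>2 / 2)) * iexp (r * x)) = of_real (sqrt (2 * pi) * exp (- r\<^sup>2 / 2))"
proof -
  have "of_real (exp (- r\<^sup>2 / 2)) = (CLINT x|density lborel std_normal_density. iexp (r * x))"
    using fun_cong[OF char_std_normal_distribution, of r] by (simp add: char_def)
  also have "\<dots> = (CLINT x|lborel. std_normal_density x *\<^sub>R iexp (r * x))"
    by (subst integral_density) auto
  finally have "of_real (sqrt (2 * pi)) * of_real (exp (- r\<^sup>2 / 2)) =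
      of_real (sqrt (2 * pi)) * (CLINT x|lborel. std_normal_density x *\<^sub>R iexp (r * x))"
    by simp
  also have "\<dots> = (CLINT x|lborel. of_real (sqrt (2 * pi)) * (std_normal_density x *\<^sub>R iexp (r * x)))"
    by (subst integral_mult_right_zero) simp
  also have "\<dots> = (LINT x|lborel. complex_of_real (exp (- x\<^sup>2 / 2)) * iexp (r * x))"
    by (intro Bochner_Integration.integral_cong refl)
       (simp only: gaussian_eq scaleR_conv_of_real of_real_mult mult.assoc)
  finally show ?thesis by simp
qed

lemma integrable_gaussian_scaled:
  assumes "\<epsilon> > 0" shows "integrable lborel (\<lambda>x::real. exp (- (\<epsilon> * x)\<^sup>2 / 2))"
  using lborel_integrable_real_affine[OF integrable_gaussian, of \<epsilon> 0] assms by simp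

lemma fourier_gaussian_scaled:
  assumes "\<epsilon> > 0"
  shows "(LINT x|lborel. complex_of_real (exp (- (\<epsilon> * x)\<^sup>2 / 2)) * iexp (r * x)) =
    of_real (sqrt (2 * pi) / \<epsilon> * exp (- (r / \<epsilon>)\<^sup>2 / 2))"
proof -
  have "(LINT x|lborel. complex_of_real (exp (- (\<epsilon> * x)\<^sup>2 / 2)) * iexp (r * x)) =
    \<bar>1 / \<epsilon>\<bar> *\<^sub>R (LINT x|lborel. complex_of_real (exp (- (\<epsilon> * (0 + 1 / \<epsilon> * x))\<^sup>2 / 2)) * iexp (r * (0 + 1 / \<epsilon> * x)))"
    using assms by (intro lborel_integral_real_affine) simp
  also have "(\<lambda>x. complex_of_real (exp (- (\<epsilon> * (0 + 1 / \<epsilon> * x))\<^sup>2 / 2)) * iexp (r * (0 + 1 / \<epsilon> * x))) =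
      (\<lambda>x. complex_of_real (exp (- x\<^sup>2 / 2)) * iexp (r / \<epsilon> * x))"
    using assms by (intro ext) simp
  also have "\<bar>1 / \<epsilon>\<bar> *\<^sub>R (LINT x|lborel. \<dots> x) = of_real (sqrt (2 * pi) / \<epsilon> * exp (- (r / \<epsilon>)\<^sup>2 / 2))"
    using assms by (subst fourier_gaussian) (simp add: scaleR_conv_of_real)
  finally show ?thesis .
qed

text \<open>A kernel bounded by 1 leaves |f(x)| |g(y)| as integrable majorant on the plane. The
  kernels meant here are oscillating exponentials.\<close>

lemma Fubini_product_kernel:
  fixes f g :: "real \<Rightarrow> complex"
  assumes f: "integrable lborel f" and g: "integrable lborel g"
    and K: "case_prod K \<in> borel_measurable (borel \<Otimes>\<^sub>M borel)" "\<And>x y. norm (K x y) \<le> 1"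
  shows "(LINT y|lborel. (LINT x|lborel. f x * g y * K x y)) = (LINT x|lborel. (LINT y|lborel. f x * g y * K x y))"
proof (rule lborel_pair.Fubini_integral)
  have [measurable]: "f \<in> borel_measurable borel" "g \<in> borel_measurable borel"
    "(\<lambda>x. K (fst x) (snd x)) \<in> borel_measurable (borel \<Otimes>\<^sub>M borel)"
    using f g K(1) by (auto simp: case_prod_beta')
  have bound: "norm (f x * g y * K x y) \<le> norm (f x) * norm (g y)" for x y
    using K(2)[of x y] by (simp add: norm_mult mult_left_le)
  have Ig: "integrable lborel (\<lambda>y. f x * g y * K x y)" for x
  proof (rule Bochner_Integration.integrable_bound)
    show "integrable lborel (\<lambda>y. norm (f x) * norm (g y))" using g by auto
    have "(\<lambda>y. K (fst (x, y)) (snd (x, y))) \<in> borel_measurable borel" by measurable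
    then show "(\<lambda>y. f x * g y * K x y) \<in> borel_measurable lborel" by simp
  qed (use bound in auto)
  show "integrable (lborel \<Otimes>\<^sub>M lborel) (\<lambda>(x, y). f x * g y * K x y)"
  proof (rule lborel_pair.Fubini_integrable)
    show "(\<lambda>(x, y). f x * g y * K x y) \<in> borel_measurable (lborel \<Otimes>\<^sub>M lborel)"
      by (simp add: case_prod_beta')
    show "integrable lborel (\<lambda>x. LINT y|lborel. norm (case (x, y) of (x, y) \<Rightarrow> f x * g y * K x y))"
    proof (rule Bochner_Integration.integrable_bound)
      show "integrable lborel (\<lambda>x. norm (f x) * (LINT y|lborel. norm (g y)))" using f by auto
      have "(\<lambda>x. LINT y|lborel. norm (f (fst (x, y)) * g (snd (x, y)) * K (fst (x, y)) (snd (x, y)))) \<in> borel_measurable lborel"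
        by measurable
      then show "(\<lambda>x. LINT y|lborel. norm (case (x, y) of (x, y) \<Rightarrow> f x * g y * K x y)) \<in> borel_measurable lborel"
        by simp
      have "(LINT y|lborel. norm (f x * g y * K x y)) \<le> (LINT y|lborel. norm (f x) * norm (g y))" for x
        using g by (intro integral_mono bound integrable_norm Ig) auto
      then show "AE x in lborel. norm (LINT y|lborel. norm (case (x, y) of (x, y) \<Rightarrow> f x * g y * K x y))
          \<le> norm (norm (f x) * (LINT y|lborel. norm (g y)))"
        by (auto simp: abs_mult)
    qed
    show "AE x in lborel. integrable lborel (\<lambda>y. case (x, y) of (x, y) \<Rightarrow> f x * g y * K x y)"
      using Ig by simp
  qed
qed

section \<open>Elementary properties of the Fourier transform\<close>

lemma fourier_bound:
  assumes "integrable lborel f"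
  shows "norm (fourier f \<omega>) \<le> (LINT t|lborel. \<bar>f t\<bar>)"
  unfolding fourier_def
  by (rule order.trans[OF integral_norm_bound]) (simp add: norm_mult)

lemma fourier_measurable [measurable]:
  assumes [measurable]: "f \<in> borel_measurable borel"
  shows "fourier f \<in> borel_measurable borel"
  unfolding fourier_def by measurable

lemma fourier_cnj:
  "cnj (fourier f \<omega>) = (LINT t|lborel. complex_of_real (f t) * iexp (\<omega> * t))"
proof -
  have "cnj (fourier f \<omega>) = (LINT t|lborel. cnj (complex_of_real (f t) * iexp (- (\<omega> * t))))"
    unfolding fourier_def by (rule Bochner_Integration.integral_cnj[symmetric])
  also have "\<dots> = (LINT t|lborel. complex_of_real (f t) * iexp (\<omega> * t))"
    by (intro Bochner_Integration.integral_cong refl) (simp add: exp_cnj)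
  finally show ?thesis .
qed

text \<open>
  The Gaussian factor makes both applications of Fubini legitimate; it is removed by monotone convergence.
\<close>

lemma plancherel_gaussian:
  fixes f :: "real \<Rightarrow> real"
  assumes f: "integrable lborel f" and f2: "integrable lborel (\<lambda>t. (f t)\<^sup>2)" and \<epsilon>: "\<epsilon> > 0"
  shows "(LINT \<omega>|lborel. (norm (fourier f \<omega>))\<^sup>2 * exp (- (\<epsilon> * \<omega>)\<^sup>2 / 2)) =
    sqrt (2 * pi) * (LINT x|lborel. exp (- x\<^sup>2 / 2) * (LINT t|lborel. f t * f (t + \<epsilon> * x)))"
proof -
  have [measurable]: "f \<in> borel_measurable borel" using f by simp
  let ?G = "\<lambda>\<omega>. exp (- (\<epsilon> * \<omega>)\<^sup>2 / 2)"
  let ?F = "fourier f"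
  have fc: "integrable lborel (\<lambda>t. complex_of_real (f t))" using f by auto
  have Gc: "integrable lborel (\<lambda>\<omega>. complex_of_real (?G \<omega>))" using integrable_gaussian_scaled[OF \<epsilon>] by auto
  \<comment> \<open>The transform of an integrable function is bounded, so the Gaussian alone
    provides the integrability.\<close>
  have FG: "integrable lborel (\<lambda>\<omega>. cnj (?F \<omega>) * ?G \<omega>)"
  proof (rule Bochner_Integration.integrable_bound)
    show "integrable lborel (\<lambda>\<omega>. (LINT t|lborel. \<bar>f t\<bar>) * ?G \<omega>)" using integrable_gaussian_scaled[OF \<epsilon>] by auto
    show "AE \<omega> in lborel. norm (cnj (?F \<omega>) * ?G \<omega>) \<le> norm ((LINT t|lborel. \<bar>f t\<bar>) * ?G \<omega>)"
      using fourier_bound[OF f] by (auto simp: norm_mult abs_mult intro!: mult_right_mono)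
    have [measurable]: "(\<lambda>\<omega>. cnj (?F \<omega>)) \<in> borel_measurable borel"
      by (rule measurable_compose[OF fourier_measurable borel_measurable_continuous_onI])
         (auto intro: continuous_intros)
    show "(\<lambda>\<omega>. cnj (?F \<omega>) * ?G \<omega>) \<in> borel_measurable lborel"
      using Gc by simp
  qed
  \<comment> \<open>Inverting the transform in the presence of the Gaussian factor gives a Gaussian
    average of \<open>f\<close> around \<open>t\<close> at scale \<epsilon>.\<close>
  have inner: "(LINT \<omega>|lborel. (cnj (?F \<omega>) * ?G \<omega>) * iexp (- (\<omega> * t))) =
      of_real (sqrt (2 * pi) * (LINT x|lborel. exp (- x\<^sup>2 / 2) * f (t + \<epsilon> * x)))" for t
  proof -
    have "(cnj (?F \<omega>) * ?G \<omega>) * iexp (- (\<omega> * t)) =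
       (LINT s|lborel. complex_of_real (f s) * ?G \<omega> * iexp (\<omega> * (s - t)))" for \<omega>
    proof -
      have "(cnj (?F \<omega>) * ?G \<omega>) * iexp (- (\<omega> * t)) =
        (LINT s|lborel. (complex_of_real (f s) * iexp (\<omega> * s)) * (?G \<omega> * iexp (- (\<omega> * t))))"
        unfolding fourier_cnj by (subst integral_mult_left_zero) (simp add: mult.assoc)
      also have "\<dots> = (LINT s|lborel. complex_of_real (f s) * ?G \<omega> * iexp (\<omega> * (s - t)))"
      proof (intro Bochner_Integration.integral_cong refl)
        fix s
        have "iexp (\<omega> * (s - t)) = iexp (\<omega> * s) * iexp (- (\<omega> * t))"
          by (simp add: algebra_simps flip: exp_add)
        then show "complex_of_real (f s) * iexp (\<omega> * s) * (?G \<omega> * iexp (- (\<omega> * t))) =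
          complex_of_real (f s) * ?G \<omega> * iexp (\<omega> * (s - t))" by (simp only: mult_ac)
      qed
      finally show ?thesis .
    qed
    then have "(LINT \<omega>|lborel. (cnj (?F \<omega>) * ?G \<omega>) * iexp (- (\<omega> * t))) =
      (LINT \<omega>|lborel. (LINT s|lborel. complex_of_real (f s) * ?G \<omega> * iexp (\<omega> * (s - t))))" by simp
    also have "\<dots> = (LINT s|lborel. (LINT \<omega>|lborel. complex_of_real (f s) * ?G \<omega> * iexp (\<omega> * (s - t))))"
      by (rule Fubini_product_kernel[OF fc Gc]) auto
    also have "\<dots> = (LINT s|lborel. complex_of_real (f s) * (LINT \<omega>|lborel. ?G \<omega> * iexp ((s - t) * \<omega>)))"
      by (simp add: mult.assoc mult.commute[of "_ - t"])
    also have "\<dots> = (LINT s|lborel. complex_of_real (f s * (sqrt (2 * pi) / \<epsilon> * exp (- ((s - t) / \<epsilon>)\<^sup>2 / 2))))"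
      unfolding fourier_gaussian_scaled[OF \<epsilon>] by (simp only: of_real_mult)
    also have "\<dots> = of_real (LINT s|lborel. f s * (sqrt (2 * pi) / \<epsilon> * exp (- ((s - t) / \<epsilon>)\<^sup>2 / 2)))"
      by (rule integral_complex_of_real)
    \<comment> \<open>Substitution s = t + \<epsilon> x; its Jacobian cancels the 1/\<epsilon> of
      the scaled Gaussian.\<close>
    also have "(LINT s|lborel. f s * (sqrt (2 * pi) / \<epsilon> * exp (- ((s - t) / \<epsilon>)\<^sup>2 / 2))) =
      \<bar>\<epsilon>\<bar> *\<^sub>R (LINT x|lborel. f (t + \<epsilon> * x) * (sqrt (2 * pi) / \<epsilon> * exp (- (((t + \<epsilon> * x) - t) / \<epsilon>)\<^sup>2 / 2)))"
      using \<epsilon> by (intro lborel_integral_real_affine) simp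
    also have "\<dots> = (LINT x|lborel. sqrt (2 * pi) * (exp (- x\<^sup>2 / 2) * f (t + \<epsilon> * x)))"
      using \<epsilon> by (subst integral_scaleR_right[symmetric]) (auto intro!: Bochner_Integration.integral_cong simp: field_simps)
    also have "\<dots> = sqrt (2 * pi) * (LINT x|lborel. exp (- x\<^sup>2 / 2) * f (t + \<epsilon> * x))"
      by (rule integral_mult_right_zero)
    finally show ?thesis .
  qed
  \<comment> \<open>Only one of the two factors \<open>?F \<omega>\<close> and
    \<open>cnj (?F \<omega>)\<close> is expanded into an integral; the other stays with the Gaussian
    as the integrable function \<open>FG\<close>.\<close>
  have "of_real ((norm (?F \<omega>))\<^sup>2 * ?G \<omega>) = (LINT t|lborel. complex_of_real (f t) * (cnj (?F \<omega>) * ?G \<omega>) * iexp (- (\<omega> * t)))" for \<omega>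
  proof -
    have "of_real ((norm (?F \<omega>))\<^sup>2 * ?G \<omega>) = ?F \<omega> * (cnj (?F \<omega>) * ?G \<omega>)"
      unfolding of_real_mult complex_norm_square by (simp only: mult.assoc)
    also have "\<dots> = (LINT t|lborel. complex_of_real (f t) * iexp (- (\<omega> * t)) * (cnj (?F \<omega>) * ?G \<omega>))"
      by (subst (1) fourier_def, rule integral_mult_left_zero[symmetric])
    finally show ?thesis by (simp only: mult_ac)
  qed
  then have "of_real (LINT \<omega>|lborel. (norm (?F \<omega>))\<^sup>2 * ?G \<omega>) =
      (LINT \<omega>|lborel. (LINT t|lborel. complex_of_real (f t) * (cnj (?F \<omega>) * ?G \<omega>) * iexp (- (\<omega> * t))))"
    by (simp only: integral_complex_of_real[symmetric])
  also have "\<dots> = (LINT t|lborel. (LINT \<omega>|lborel. complex_of_real (f t) * (cnj (?F \<omega>) * ?G \<omega>) * iexp (- (\<omega> * t))))"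
    by (rule Fubini_product_kernel[OF fc FG]) auto
  also have "\<dots> = (LINT t|lborel. complex_of_real (f t) * (LINT \<omega>|lborel. (cnj (?F \<omega>) * ?G \<omega>) * iexp (- (\<omega> * t))))"
    by (simp only: mult.assoc integral_mult_right_zero)
  also have "\<dots> = (LINT t|lborel. complex_of_real (f t * (sqrt (2 * pi) * (LINT x|lborel. exp (- x\<^sup>2 / 2) * f (t + \<epsilon> * x)))))"
    unfolding inner by (simp only: of_real_mult)
  also have "\<dots> = of_real (LINT t|lborel. f t * (sqrt (2 * pi) * (LINT x|lborel. exp (- x\<^sup>2 / 2) * f (t + \<epsilon> * x))))"
    by (rule integral_complex_of_real)
  finally have "(LINT \<omega>|lborel. (norm (?F \<omega>))\<^sup>2 * ?G \<omega>) =
      (LINT t|lborel. f t * (sqrt (2 * pi) * (LINT x|lborel. exp (- x\<^sup>2 / 2) * f (t + \<epsilon> * x))))"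
    by (simp only: of_real_eq_iff)
  also have "\<dots> = sqrt (2 * pi) * (LINT t|lborel. (LINT x|lborel. exp (- x\<^sup>2 / 2) * (f t * f (t + \<epsilon> * x))))"
    by (simp add: mult_ac flip: integral_mult_right_zero)
  \<comment> \<open>Here the integrand is no product of a function of \<open>t\<close> and a
    function of \<open>x\<close> with a bounded kernel. Integrability on the plane comes from the
    autocorrelation bound, which is uniform in \<open>x\<close>.\<close>
  also have "(LINT t|lborel. (LINT x|lborel. exp (- x\<^sup>2 / 2) * (f t * f (t + \<epsilon> * x)))) =
      (LINT x|lborel. (LINT t|lborel. exp (- x\<^sup>2 / 2) * (f t * f (t + \<epsilon> * x))))"
  proof (rule lborel_pair.Fubini_integral)
    have bound: "(LINT t|lborel. norm (exp (- x\<^sup>2 / 2) * (f t * f (t + \<epsilon> * x)))) \<le> exp (- x\<^sup>2 / 2) * (LINT t|lborel. (f t)\<^sup>2)" for x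
      using autocorrelation_abs_le[OF _ f2, of "\<epsilon> * x"] by (simp add: abs_mult)
    show "integrable (lborel \<Otimes>\<^sub>M lborel) (\<lambda>(x, t). exp (- x\<^sup>2 / 2) * (f t * f (t + \<epsilon> * x)))"
    proof (rule lborel_pair.Fubini_integrable)
      show "integrable lborel (\<lambda>x. LINT t|lborel. norm (case (x, t) of (x, t) \<Rightarrow> exp (- x\<^sup>2 / 2) * (f t * f (t + \<epsilon> * x))))"
      proof (rule Bochner_Integration.integrable_bound)
        show "integrable lborel (\<lambda>x. exp (- x\<^sup>2 / 2) * (LINT t|lborel. (f t)\<^sup>2))"
          using integrable_gaussian by auto
        show "AE x in lborel. norm (LINT t|lborel. norm (case (x, t) of (x, t) \<Rightarrow> exp (- x\<^sup>2 / 2) * (f t * f (t + \<epsilon> * x))))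
            \<le> norm (exp (- x\<^sup>2 / 2) * (LINT t|lborel. (f t)\<^sup>2))"
          using bound by (auto intro!: AE_I2 intro: order.trans[OF _ abs_ge_self] simp: abs_of_nonneg Bochner_Integration.integral_nonneg)
      qed simp
      show "AE x in lborel. integrable lborel (\<lambda>t. case (x, t) of (x, t) \<Rightarrow> exp (- x\<^sup>2 / 2) * (f t * f (t + \<epsilon> * x)))"
        using autocorrelation_integrable[OF _ f2] by auto
    qed measurable
  qed
  finally show ?thesis by simp
qed

text \<open>Let \<epsilon> = 1/(n+1) tend to 0. On the frequency side the Gaussian factors increase
  to 1, so monotone convergence also yields integrability. On the time side the autocorrelation
  tends to its value at shift 0, dominated by a Gaussian.\<close>

lemma plancherel:
  fixes f :: "real \<Rightarrow> real"
  assumes f: "integrable lborel f" and f2: "integrable lborel (\<lambda>t. (f t)\<^sup>2)"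
  shows plancherel_integrable: "integrable lborel (\<lambda>\<omega>. (norm (fourier f \<omega>))\<^sup>2)"
    and plancherel_eq: "(LINT \<omega>|lborel. (norm (fourier f \<omega>))\<^sup>2) = 2 * pi * (LINT t|lborel. (f t)\<^sup>2)"
proof -
  have [measurable]: "f \<in> borel_measurable borel" using f by simp
  let ?I = "LINT t|lborel. (f t)\<^sup>2"
  define e where "e = (\<lambda>n::nat. inverse (real (Suc n)))"
  have e: "e n > 0" for n by (simp add: e_def)
  have e0: "e \<longlonglongrightarrow> 0" unfolding e_def by (rule LIMSEQ_inverse_real_of_nat)
  let ?s = "\<lambda>n \<omega>. (norm (fourier f \<omega>))\<^sup>2 * exp (- (e n * \<omega>)\<^sup>2 / 2)"
  have I: "integrable lborel (?s n)" for n
  proof (rule Bochner_Integration.integrable_bound)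
    show "integrable lborel (\<lambda>\<omega>. (LINT t|lborel. \<bar>f t\<bar>)\<^sup>2 * exp (- (e n * \<omega>)\<^sup>2 / 2))"
      using integrable_gaussian_scaled[OF e] by auto
    show "AE \<omega> in lborel. norm (?s n \<omega>) \<le> norm ((LINT t|lborel. \<bar>f t\<bar>)\<^sup>2 * exp (- (e n * \<omega>)\<^sup>2 / 2))"
      using fourier_bound[OF f] by (auto simp: abs_mult intro!: mult_right_mono power_mono)
  qed measurable
  have mono: "mono (\<lambda>n. ?s n \<omega>)" for \<omega>
  proof (intro monoI mult_left_mono)
    fix m n :: nat assume "m \<le> n"
    then have "e n \<le> e m" by (simp add: e_def divide_simps)
    then have "(e n * \<omega>)\<^sup>2 \<le> (e m * \<omega>)\<^sup>2"
      using e[of n] by (simp add: power_mult_distrib mult_right_mono power_mono less_imp_le)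
    then show "exp (- (e m * \<omega>)\<^sup>2 / 2) \<le> exp (- (e n * \<omega>)\<^sup>2 / 2)" by simp
  qed simp
  have lim: "(\<lambda>n. ?s n \<omega>) \<longlonglongrightarrow> (norm (fourier f \<omega>))\<^sup>2" for \<omega>
  proof -
    have "(\<lambda>n. ?s n \<omega>) \<longlonglongrightarrow> (norm (fourier f \<omega>))\<^sup>2 * exp (- (0 * \<omega>)\<^sup>2 / 2)"
      by (intro tendsto_intros e0) simp
    then show ?thesis by simp
  qed
  have "(\<lambda>n. LINT x|lborel. exp (- x\<^sup>2 / 2) * (LINT t|lborel. f t * f (t + e n * x))) \<longlonglongrightarrow>
      (LINT x|lborel. exp (- x\<^sup>2 / 2) * ?I)"
  proof (rule integral_dominated_convergence)
    show "integrable lborel (\<lambda>x. exp (- x\<^sup>2 / 2) * ?I)" using integrable_gaussian by auto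
    show "AE x in lborel. norm (exp (- x\<^sup>2 / 2) * (LINT t|lborel. f t * f (t + e n * x))) \<le> exp (- x\<^sup>2 / 2) * ?I" for n
    proof (rule AE_I2)
      fix x
      have "\<bar>LINT t|lborel. f t * f (t + e n * x)\<bar> \<le> (LINT t|lborel. \<bar>f t * f (t + e n * x)\<bar>)"
        by (rule integral_abs_bound)
      also have "\<dots> \<le> ?I" by (rule autocorrelation_abs_le[OF _ f2]) simp
      finally have "\<bar>LINT t|lborel. f t * f (t + e n * x)\<bar> \<le> ?I" .
      then show "norm (exp (- x\<^sup>2 / 2) * (LINT t|lborel. f t * f (t + e n * x))) \<le> exp (- x\<^sup>2 / 2) * ?I"
        by (simp add: abs_mult)
    qed
    show "AE x in lborel. (\<lambda>n. exp (- x\<^sup>2 / 2) * (LINT t|lborel. f t * f (t + e n * x))) \<longlonglongrightarrow> exp (- x\<^sup>2 / 2) * ?I"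
    proof (intro AE_I2 tendsto_mult tendsto_const autocorrelation_tendsto f2)
      fix x
      have "(\<lambda>n. e n * x) \<longlonglongrightarrow> 0 * x" by (intro tendsto_intros e0)
      then show "(\<lambda>n. e n * x) \<longlonglongrightarrow> 0" by simp
    qed simp
  qed simp_all
  then have "(\<lambda>n. sqrt (2 * pi) * (LINT x|lborel. exp (- x\<^sup>2 / 2) * (LINT t|lborel. f t * f (t + e n * x)))) \<longlonglongrightarrow>
      sqrt (2 * pi) * (LINT x|lborel. exp (- x\<^sup>2 / 2) * ?I)"
    by (intro tendsto_mult tendsto_const)
  also have "sqrt (2 * pi) * (LINT x|lborel. exp (- x\<^sup>2 / 2) * ?I) = 2 * pi * ?I"
    unfolding integral_mult_left_zero integral_gaussian by (simp flip: mult.assoc)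
  finally have ilim: "(\<lambda>n. integral\<^sup>L lborel (?s n)) \<longlonglongrightarrow> 2 * pi * ?I"
    unfolding plancherel_gaussian[OF f f2 e] .
  show "integrable lborel (\<lambda>\<omega>. (norm (fourier f \<omega>))\<^sup>2)"
    by (rule integrable_monotone_convergence[OF I _ _ ilim]) (use mono lim in auto)
  show "(LINT \<omega>|lborel. (norm (fourier f \<omega>))\<^sup>2) = 2 * pi * ?I"
    by (rule integral_monotone_convergence[OF I _ _ ilim]) (use mono lim in auto)
qed

lemma fourier_add:
  assumes "integrable lborel f" "integrable lborel g"
  shows "fourier (\<lambda>t. f t + g t) \<omega> = fourier f \<omega> + fourier g \<omega>"
proof -
  have *: "integrable lborel (\<lambda>t. complex_of_real (f t) * iexp (- (\<omega> * t)))" if f: "integrable lborel f" for f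
    by (rule Bochner_Integration.integrable_bound[OF f]) (use f in \<open>auto simp: norm_mult\<close>)
  show ?thesis
    unfolding fourier_def using Bochner_Integration.integral_add[OF *[OF assms(1)] *[OF assms(2)]]
    by (simp add: distrib_right)
qed

text \<open>Polarisation of Plancherel's identity for f, g and f + g. The inner product on the
  complex numbers is the real one, Re(cnj a * b), so this is the real part of the usual identity,
  which is enough for real signals.\<close>

lemma parseval:
  fixes f g :: "real \<Rightarrow> real"
  assumes f: "integrable lborel f" "integrable lborel (\<lambda>t. (f t)\<^sup>2)"
    and g: "integrable lborel g" "integrable lborel (\<lambda>t. (g t)\<^sup>2)"
  shows parseval_integrable: "integrable lborel (\<lambda>\<omega>. fourier f \<omega> \<bullet> fourier g \<omega>)"
    and parseval_eq: "(LINT \<omega>|lborel. fourier f \<omega> \<bullet> fourier g \<omega>) = 2 * pi * (LINT t|lborel. f t * g t)"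
proof -
  have [measurable]: "f \<in> borel_measurable borel" "g \<in> borel_measurable borel" using f g by auto
  have s: "integrable lborel (\<lambda>t. f t + g t)" using f g by auto
  have fg: "integrable lborel (\<lambda>t. f t * g t)"
  proof (rule Bochner_Integration.integrable_bound)
    show "integrable lborel (\<lambda>t. (f t)\<^sup>2 + (g t)\<^sup>2)" using f g by auto
    show "AE t in lborel. norm (f t * g t) \<le> norm ((f t)\<^sup>2 + (g t)\<^sup>2)"
      using abs_mult_le_sum_squares by simp
  qed measurable
  have sq: "(\<lambda>t. (f t + g t)\<^sup>2) = (\<lambda>t. (f t)\<^sup>2 + (g t)\<^sup>2 + 2 * (f t * g t))"
    by (simp add: fun_eq_iff power2_sum)
  have s2: "integrable lborel (\<lambda>t. (f t + g t)\<^sup>2)"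
    unfolding sq by (intro Bochner_Integration.integrable_add integrable_mult_right f g fg)
  have Is: "(LINT t|lborel. (f t + g t)\<^sup>2) = (LINT t|lborel. (f t)\<^sup>2) + (LINT t|lborel. (g t)\<^sup>2) + 2 * (LINT t|lborel. f t * g t)"
    unfolding sq using f g fg by simp
  let ?P = "\<lambda>f \<omega>. (norm (fourier f \<omega>))\<^sup>2"
  have eq: "(\<lambda>\<omega>. fourier f \<omega> \<bullet> fourier g \<omega>) = (\<lambda>\<omega>. (?P (\<lambda>t. f t + g t) \<omega> - ?P f \<omega> - ?P g \<omega>) / 2)"
    by (simp add: fun_eq_iff fourier_add f g dot_norm)
  show "integrable lborel (\<lambda>\<omega>. fourier f \<omega> \<bullet> fourier g \<omega>)"
    unfolding eq by (intro integrable_divide Bochner_Integration.integrable_diff plancherel_integrable f g s s2)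
  show "(LINT \<omega>|lborel. fourier f \<omega> \<bullet> fourier g \<omega>) = 2 * pi * (LINT t|lborel. f t * g t)"
    unfolding eq using plancherel_integrable[OF f] plancherel_integrable[OF g] plancherel_integrable[OF s s2]
    by (simp add: plancherel_eq f g s s2 Is algebra_simps)
qed

subsection \<open>Quadratic forms of the transfer matrix\<close>

lemma norm_matrix_vector_mult_le:
  fixes M :: "complex ^ 'n::finite ^ 'n"
  shows "norm (M *v x) \<le> (\<Sum>i\<in>UNIV. \<Sum>j\<in>UNIV. norm (M $ i $ j)) * norm x"
proof -
  have "norm (M *v x) \<le> (\<Sum>i\<in>UNIV. norm ((M *v x) $ i))"
    unfolding norm_vec_def by (rule L2_set_le_sum) simp
  also have "\<dots> \<le> (\<Sum>i\<in>UNIV. \<Sum>j\<in>UNIV. norm (M $ i $ j) * norm x)"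
  proof (rule sum_mono)
    fix i
    have "norm ((M *v x) $ i) \<le> (\<Sum>j\<in>UNIV. norm (M $ i $ j * x $ j))"
      by (simp add: matrix_vector_mult_def norm_sum)
    also have "\<dots> \<le> (\<Sum>j\<in>UNIV. norm (M $ i $ j) * norm x)"
      by (intro sum_mono) (simp add: norm_mult mult_left_mono Finite_Cartesian_Product.norm_nth_le)
    finally show "norm ((M *v x) $ i) \<le> (\<Sum>j\<in>UNIV. norm (M $ i $ j) * norm x)" .
  qed
  finally show ?thesis by (simp add: sum_distrib_right)
qed

lemma RH_inf_bounded:
  fixes H :: "('n::finite) transfer_matrix"
  assumes "H \<in> RH_inf"
  obtains M where "\<And>s x. Re s \<ge> 0 \<Longrightarrow> norm (tf_eval H s *v x) \<le> M * norm x"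
proof -
  have "\<forall>i j. \<exists>C. \<forall>s. Re s \<ge> 0 \<longrightarrow> norm (rat_eval (H $ i $ j) s) \<le> C"
    using assms bounded_stable_rat(1) by (auto simp: RH_inf_def)
  then obtain C where C: "\<And>i j s. Re s \<ge> 0 \<Longrightarrow> norm (rat_eval (H $ i $ j) s) \<le> C i j"
    by metis
  let ?M = "\<Sum>i\<in>UNIV. \<Sum>j\<in>UNIV. C i j"
  have "norm (tf_eval H s *v x) \<le> ?M * norm x" if "Re s \<ge> 0" for s x
    by (intro order.trans[OF norm_matrix_vector_mult_le] mult_right_mono sum_mono)
       (auto simp: tf_eval_def C that)
  then show ?thesis using that by blast
qed

text \<open>The entrywise Lipschitz constants add up. Uniformity in the frequency is the point: it
  compares the line Re s = \<sigma> with the imaginary axis at a cost proportional to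
  \<sigma>.\<close>

lemma RH_inf_lipschitz:
  fixes H :: "('n::finite) transfer_matrix"
  assumes "H \<in> RH_inf"
  obtains L where "\<And>s t x. Re s \<ge> 0 \<Longrightarrow> Re t \<ge> 0 \<Longrightarrow>
    norm (tf_eval H s *v x - tf_eval H t *v x) \<le> L * norm (s - t) * norm x"
proof -
  have "\<forall>i j. \<exists>C. \<forall>s t. Re s \<ge> 0 \<longrightarrow> Re t \<ge> 0 \<longrightarrow>
      norm (rat_eval (H $ i $ j) s - rat_eval (H $ i $ j) t) \<le> C * norm (s - t)"
    using assms bounded_stable_rat(2) by (auto simp: RH_inf_def)
  then obtain C where C: "\<And>i j s t. Re s \<ge> 0 \<Longrightarrow> Re t \<ge> 0 \<Longrightarrow>
      norm (rat_eval (H $ i $ j) s - rat_eval (H $ i $ j) t) \<le> C i j * norm (s - t)"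
    by metis
  let ?L = "\<Sum>i\<in>UNIV. \<Sum>j\<in>UNIV. C i j"
  have "norm (tf_eval H s *v x - tf_eval H t *v x) \<le> ?L * norm (s - t) * norm x"
    if "Re s \<ge> 0" "Re t \<ge> 0" for s t x
    unfolding matrix_vector_mult_diff_rdistrib[symmetric] sum_distrib_right[of _ _ "norm (s - t)"]
    by (intro order.trans[OF norm_matrix_vector_mult_le] mult_right_mono sum_mono)
       (auto simp: tf_eval_def C that)
  then show ?thesis using that by blast
qed

section \<open>Hermitian forms expressed through the real inner product\<close>

lemma inner_complex_eq: "x \<bullet> y = Re (cnj x * y)" for x y :: complex
  by (simp add: inner_complex_def)

lemma scaleR_matrix_vector:
  fixes M :: "complex ^ 'n::finite ^ 'n"
  shows "(c *\<^sub>R M) *v x = c *\<^sub>R (M *v x)"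
  by (simp add: vec_eq_iff matrix_vector_mult_def scaleR_sum_right)

text \<open>The inner product of complex vectors is the real part of the Hermitian one, and the
  conjugate transpose remains the adjoint for it.\<close>

lemma inner_conj_transpose:
  fixes M :: "complex ^ 'n::finite ^ 'n"
  shows "x \<bullet> (conj_transpose M *v y) = (M *v x) \<bullet> y"
proof -
  have "x \<bullet> (conj_transpose M *v y) = (\<Sum>i\<in>UNIV. \<Sum>j\<in>UNIV. Re (cnj (x $ i) * cnj (M $ j $ i) * y $ j))"
    by (simp add: inner_vec_def inner_complex_eq matrix_vector_mult_def conj_transpose_def sum_distrib_left mult.assoc
        del: complex_cnj_mult)
  also have "\<dots> = (\<Sum>j\<in>UNIV. \<Sum>i\<in>UNIV. Re (cnj (x $ i) * cnj (M $ j $ i) * y $ j))"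
    by (rule sum.swap)
  also have "\<dots> = (\<Sum>j\<in>UNIV. Re (cnj (\<Sum>i\<in>UNIV. M $ j $ i * x $ i) * y $ j))"
    by (simp only: cnj_sum complex_cnj_mult sum_distrib_left sum_distrib_right Re_sum mult_ac)
  also have "\<dots> = (M *v x) \<bullet> y"
    by (simp only: inner_vec_def inner_complex_eq matrix_vector_mult_def vec_lambda_beta)
  finally show ?thesis .
qed

lemma neg_semidef_inner:
  fixes M :: "complex ^ 'n::finite ^ 'n"
  assumes "neg_semidef M"
  shows "x \<bullet> (M *v x) \<le> 0"
  using assms by (simp add: neg_semidef_def inner_vec_def inner_complex_eq)

text \<open>The Hermitian part is self-adjoint. The skew-Hermitian part contributes an imaginary
  number to the Hermitian form, which the real inner product does not see.\<close>

lemma hermitian_part_inner: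
  fixes M :: "complex ^ 'n::finite ^ 'n"
  shows "x \<bullet> (hermitian_part M *v y) = (hermitian_part M *v x) \<bullet> y"
    and "x \<bullet> (hermitian_part M *v x) = x \<bullet> (M *v x)"
proof -
  have *: "hermitian_part M *v x = (1 / 2) *\<^sub>R (M *v x + conj_transpose M *v x)" for x
    by (simp add: hermitian_part_def matrix_vector_mult_add_rdistrib scaleR_matrix_vector)
  show "x \<bullet> (hermitian_part M *v y) = (hermitian_part M *v x) \<bullet> y"
    unfolding * by (simp add: inner_add_left inner_add_right inner_conj_transpose inner_commute[of "conj_transpose M *v x"])
       (simp add: inner_commute)
  show "x \<bullet> (hermitian_part M *v x) = x \<bullet> (M *v x)"
    unfolding * by (simp add: inner_add_right inner_conj_transpose inner_commute[of "M *v x"])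
qed

text \<open>
  Replacing \<open>\<alpha> |H\<^sub>s x|\<^sup>2\<close> by its tangent lower bound at a real parameter \<open>c\<close> leaves an inequality that is
  linear in \<open>x \<bullet> A x\<close>, \<open>|A x|\<^sup>2\<close> and \<open>|x|\<^sup>2\<close>, so it survives integration over the frequency.
\<close>

lemma quadratic_form_bound:
  fixes A :: "complex ^ 'n::finite ^ 'n"
  assumes "neg_semidef (\<alpha> *\<^sub>R (hermitian_part A ** hermitian_part A) + \<beta> *\<^sub>R (conj_transpose A ** A)
      + (2 * \<gamma>) *\<^sub>R hermitian_part A + \<kappa> *\<^sub>R mat 1)" and "\<alpha> \<ge> 0"
  shows "(2 * \<alpha> * c + 2 * \<gamma>) * (x \<bullet> (A *v x)) + \<beta> * (norm (A *v x))\<^sup>2 + (\<kappa> - \<alpha> * c\<^sup>2) * (norm x)\<^sup>2 \<le> 0"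
proof -
  let ?S = "hermitian_part A"
  have "(\<alpha> *\<^sub>R (?S ** ?S) + \<beta> *\<^sub>R (conj_transpose A ** A) + (2 * \<gamma>) *\<^sub>R ?S + \<kappa> *\<^sub>R mat 1) *v x =
      \<alpha> *\<^sub>R (?S *v (?S *v x)) + \<beta> *\<^sub>R (conj_transpose A *v (A *v x)) + (2 * \<gamma>) *\<^sub>R (?S *v x) + \<kappa> *\<^sub>R x"
    by (simp add: matrix_vector_mult_add_rdistrib scaleR_matrix_vector matrix_vector_mul_assoc)
  moreover have "x \<bullet> (?S *v (?S *v x)) = (?S *v x) \<bullet> (?S *v x)"
    by (rule hermitian_part_inner(1))
  ultimately have form: "\<alpha> * (norm (?S *v x))\<^sup>2 + \<beta> * (norm (A *v x))\<^sup>2 + 2 * \<gamma> * (x \<bullet> (A *v x)) + \<kappa> * (norm x)\<^sup>2 \<le> 0"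
    using neg_semidef_inner[OF assms(1), of x]
    by (simp add: inner_add_right hermitian_part_inner(2) inner_conj_transpose power2_norm_eq_inner)
  have square: "(norm (?S *v x - c *\<^sub>R x))\<^sup>2 = (norm (?S *v x))\<^sup>2 - 2 * c * (x \<bullet> (A *v x)) + c\<^sup>2 * (norm x)\<^sup>2"
    unfolding power2_norm_eq_inner
    by (simp add: inner_diff_left inner_diff_right hermitian_part_inner(2)[of x A, symmetric] inner_commute power2_eq_square algebra_simps)
  have "0 \<le> \<alpha> * (norm (?S *v x - c *\<^sub>R x))\<^sup>2"
    using \<open>\<alpha> \<ge> 0\<close> by (intro mult_nonneg_nonneg zero_le_power2)
  note nonneg = this[unfolded square]
  \<comment> \<open>Subtracting \<alpha> times the square from the form cancels the term in the
    Hermitian part. With norms and inner products replaced by real variables this is plain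
    arithmetic.\<close>
  have "(2 * \<alpha> * c + 2 * \<gamma>) * a + \<beta> * w + (\<kappa> - \<alpha> * c\<^sup>2) * n \<le> 0"
    if "\<alpha> * s + \<beta> * w + 2 * \<gamma> * a + \<kappa> * n \<le> 0" "0 \<le> \<alpha> * (s - 2 * c * a + c\<^sup>2 * n)" for s w a n :: real
    using that by (simp add: algebra_simps)
  from this[OF form nonneg] show ?thesis .
qed

text \<open>Meant for \<open>v\<close> the response on the imaginary axis and \<open>w\<close> the
  one on Re s = \<sigma>, with \<open>d\<close> of order \<sigma>. The bilinear term is handled by
  Cauchy-Schwarz, the squares by factoring their difference.\<close>

lemma quadratic_form_perturb:
  fixes x v w :: "'a::real_inner"
  assumes "b * (x \<bullet> v) + g * (norm v)\<^sup>2 + k * (norm x)\<^sup>2 \<le> 0"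
    and d: "norm (w - v) \<le> d * norm x" and M: "norm v \<le> M * norm x" "norm w \<le> M * norm x"
  shows "b * (x \<bullet> w) + g * (norm w)\<^sup>2 + k * (norm x)\<^sup>2 \<le> (\<bar>b\<bar> + 2 * M * \<bar>g\<bar>) * d * (norm x)\<^sup>2"
proof -
  have "\<bar>x \<bullet> (w - v)\<bar> \<le> norm x * norm (w - v)" by (rule Cauchy_Schwarz_ineq2)
  also have "\<dots> \<le> norm x * (d * norm x)" by (intro mult_left_mono d) simp
  finally have "\<bar>b\<bar> * \<bar>x \<bullet> (w - v)\<bar> \<le> \<bar>b\<bar> * (d * (norm x)\<^sup>2)"
    by (intro mult_left_mono) (simp_all add: power2_eq_square mult_ac)
  then have "b * (x \<bullet> (w - v)) \<le> \<bar>b\<bar> * (d * (norm x)\<^sup>2)"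
    using abs_ge_self[of "b * (x \<bullet> (w - v))"] unfolding abs_mult by linarith
  then have 1: "b * (x \<bullet> w) - b * (x \<bullet> v) \<le> \<bar>b\<bar> * (d * (norm x)\<^sup>2)"
    by (simp only: inner_diff_right right_diff_distrib)
  have "\<bar>(norm w)\<^sup>2 - (norm v)\<^sup>2\<bar> = \<bar>norm w - norm v\<bar> * (norm w + norm v)"
    by (simp add: power2_eq_square square_diff_square_factored abs_mult mult.commute)
  also have "\<dots> \<le> (d * norm x) * (M * norm x + M * norm x)"
    using norm_triangle_ineq3[of w v] d M by (intro mult_mono) (auto intro: order.trans[OF norm_ge_zero])
  finally have "\<bar>g\<bar> * \<bar>(norm w)\<^sup>2 - (norm v)\<^sup>2\<bar> \<le> \<bar>g\<bar> * (2 * M * d * (norm x)\<^sup>2)"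
    by (intro mult_left_mono) (simp_all add: power2_eq_square algebra_simps)
  then have "g * ((norm w)\<^sup>2 - (norm v)\<^sup>2) \<le> \<bar>g\<bar> * (2 * M * d * (norm x)\<^sup>2)"
    using abs_ge_self[of "g * ((norm w)\<^sup>2 - (norm v)\<^sup>2)"] unfolding abs_mult by linarith
  then have "g * (norm w)\<^sup>2 - g * (norm v)\<^sup>2 \<le> \<bar>g\<bar> * (2 * M * d * (norm x)\<^sup>2)"
    by (simp only: right_diff_distrib)
  with 1 assms(1) show ?thesis by (simp add: algebra_simps)
qed

subsection \<open>From the frequency domain to signals\<close>

text \<open>The decay exp(-\<sigma> t) is absorbed into the signal, which is extended by 0 to the
  whole line, so the Laplace transform on Re s = \<sigma> becomes the Fourier transform of a real
  scalar function.\<close>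

definition damped :: "(real \<Rightarrow> real ^ 'n::finite) \<Rightarrow> real \<Rightarrow> 'n \<Rightarrow> real \<Rightarrow> real" where
  "damped u \<sigma> i t = indicator {0..} t * (exp (- (\<sigma> * t)) * u t $ i)"

lemma laplace_eq_fourier:
  "laplace u (Complex \<sigma> \<omega>) $ i = fourier (damped u \<sigma> i) \<omega>"
proof -
  have "exp (- (Complex \<sigma> \<omega> * of_real t)) = of_real (exp (- (\<sigma> * t))) * iexp (- (\<omega> * t))" for t
  proof -
    have "- (Complex \<sigma> \<omega> * of_real t) = of_real (- (\<sigma> * t)) + \<i> * of_real (- (\<omega> * t))"
      by (simp add: complex_eq_iff)
    then show ?thesis by (simp only: exp_add exp_of_real)
  qed
  then show ?thesis
    unfolding laplace_def fourier_def damped_def set_lebesgue_integral_def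
    by (auto intro!: Bochner_Integration.integral_cong simp: scaleR_conv_of_real mult_ac)
qed

lemma L2_nth_measurable:
  fixes u :: "real \<Rightarrow> real ^ 'n::finite"
  assumes "u \<in> L2" shows "(\<lambda>t. indicator {0..} t * u t $ i) \<in> borel_measurable borel"
proof -
  have "(\<lambda>t. indicator {0..} t *\<^sub>R u t) \<in> borel_measurable borel"
    using assms by (simp add: L2_def set_borel_measurable_def)
  then have "(\<lambda>t. (indicator {0..} t *\<^sub>R u t) $ i) \<in> borel_measurable borel"
    by (rule measurable_compose[OF _ borel_measurable_continuous_onI]) (auto intro: continuous_intros)
  then show ?thesis by simp
qed

lemma L2_integrable_inner:
  assumes u: "u \<in> L2" and y: "y \<in> L2"
  shows "set_integrable lborel {0..} (\<lambda>t. u t \<bullet> y t)"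
proof -
  have [measurable]: "(\<lambda>t. indicator {0..} t * u t $ i) \<in> borel_measurable borel"
    "(\<lambda>t. indicator {0..} t * y t $ i) \<in> borel_measurable borel" for i
    using u y by (auto intro: L2_nth_measurable)
  have eq: "(\<lambda>t. indicator {0..} t *\<^sub>R (u t \<bullet> y t)) =
      (\<lambda>t. \<Sum>i\<in>UNIV. (indicator {0..} t * u t $ i) * (indicator {0..} t * y t $ i))"
    by (auto simp: fun_eq_iff inner_vec_def indicator_def)
  have "integrable lborel (\<lambda>t. indicator {0..} t *\<^sub>R (norm (u t))\<^sup>2 + indicator {0..} t *\<^sub>R (norm (y t))\<^sup>2)"
    using u y by (auto simp: L2_def set_integrable_def)
  then show ?thesis
    unfolding set_integrable_def
  proof (rule Bochner_Integration.integrable_bound)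
    have "\<bar>a \<bullet> b\<bar> \<le> (norm a)\<^sup>2 + (norm b)\<^sup>2" for a b :: "real ^ 'a"
      using Cauchy_Schwarz_ineq2[of a b] sum_squares_bound[of "norm a" "norm b"]
        mult_nonneg_nonneg[OF norm_ge_zero norm_ge_zero, of a b] by linarith
    then show "AE t in lborel. norm (indicator {0..} t *\<^sub>R (u t \<bullet> y t)) \<le>
        norm (indicator {0..} t *\<^sub>R (norm (u t))\<^sup>2 + indicator {0..} t *\<^sub>R (norm (y t))\<^sup>2)"
      by (auto simp: indicator_def)
    show "(\<lambda>t. indicator {0..} t *\<^sub>R (u t \<bullet> y t)) \<in> borel_measurable lborel"
      unfolding eq by measurable
  qed
qed

lemma l2_norm_eq: "(l2_norm u)\<^sup>2 = l2_inner u u"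
proof -
  have "0 \<le> l2_inner u u"
    unfolding l2_inner_def set_lebesgue_integral_def by (intro Bochner_Integration.integral_nonneg) simp
  then show ?thesis by (simp add: l2_norm_def)
qed

lemma l2_norm_nonneg: "0 \<le> l2_norm u"
  unfolding l2_norm_def by (metis l2_norm_eq real_sqrt_ge_zero zero_le_power2)

text \<open>The product of the decay factor and an L2 component is bounded by the sum of their
  squares, both integrable. For the square the decay factor is simply at most 1.\<close>

lemma damped_integrable:
  assumes u: "u \<in> L2" and "\<sigma> > 0"
  shows "integrable lborel (damped u \<sigma> i)" and "integrable lborel (\<lambda>t. (damped u \<sigma> i t)\<^sup>2)"
proof -
  have u2: "integrable lborel (\<lambda>t. indicator {0..} t *\<^sub>R (norm (u t))\<^sup>2)"
    using u by (simp add: L2_def set_integrable_def)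
  have eq: "damped u \<sigma> i = (\<lambda>t. exp (- (\<sigma> * t)) * (indicator {0..} t * u t $ i))"
    by (simp add: fun_eq_iff damped_def)
  have [measurable]: "damped u \<sigma> i \<in> borel_measurable borel"
    unfolding eq using L2_nth_measurable[OF u] by simp
  have le: "(u t $ i)\<^sup>2 \<le> (norm (u t))\<^sup>2" for t
    using component_le_norm_cart[of "u t" i] by (simp add: abs_le_square_iff[symmetric])
  \<comment> \<open>The Erlang density of order 0 is the exponential density; divided by its rate
    2\<sigma> it is exp(-2\<sigma> t) on the half-line.\<close>
  have "integrable lborel (erlang_density 0 (2 * \<sigma>))"
    by (rule integrableI_nn_integral_finite[where x = 1])
       (use nn_integral_erlang_ith_moment[of "2 * \<sigma>" 0 0] \<open>\<sigma> > 0\<close> in auto)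
  then have "integrable lborel (\<lambda>x. erlang_density 0 (2 * \<sigma>) x / (2 * \<sigma>))"
    by (rule integrable_divide)
  also have "(\<lambda>x. erlang_density 0 (2 * \<sigma>) x / (2 * \<sigma>)) = (\<lambda>x. indicator {0..} x * exp (- (2 * \<sigma> * x)))"
    using \<open>\<sigma> > 0\<close> by (auto simp: fun_eq_iff erlang_density_def indicator_def)
  finally have I: "integrable lborel (\<lambda>t. indicator {0..} t * exp (- (2 * \<sigma> * t)) + indicator {0..} t *\<^sub>R (norm (u t))\<^sup>2)"
    using u2 by (rule Bochner_Integration.integrable_add)
  show "integrable lborel (damped u \<sigma> i)"
  proof (rule Bochner_Integration.integrable_bound[OF I])
    have "\<bar>exp (- (\<sigma> * t)) * u t $ i\<bar> \<le> exp (- (2 * \<sigma> * t)) + (norm (u t))\<^sup>2" for t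
    proof -
      have "2 * \<bar>exp (- (\<sigma> * t)) * u t $ i\<bar> \<le> (exp (- (\<sigma> * t)))\<^sup>2 + (u t $ i)\<^sup>2"
        using sum_squares_bound[of "exp (- (\<sigma> * t))" "\<bar>u t $ i\<bar>"] by (simp add: abs_mult mult_ac)
      also have "(exp (- (\<sigma> * t)))\<^sup>2 = exp (- (2 * \<sigma> * t))"
        by (simp flip: exp_double)
      finally show ?thesis using le[of t] by linarith
    qed
    then show "AE t in lborel. norm (damped u \<sigma> i t) \<le>
        norm (indicator {0..} t * exp (- (2 * \<sigma> * t)) + indicator {0..} t *\<^sub>R (norm (u t))\<^sup>2)"
      by (auto simp: damped_def indicator_def)
  qed simp
  show "integrable lborel (\<lambda>t. (damped u \<sigma> i t)\<^sup>2)"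
  proof (rule Bochner_Integration.integrable_bound[OF u2])
    have "(exp (- (\<sigma> * t)) * u t $ i)\<^sup>2 \<le> (norm (u t))\<^sup>2" if "t \<ge> 0" for t
    proof -
      have "(exp (- (\<sigma> * t)))\<^sup>2 * (u t $ i)\<^sup>2 \<le> 1 * (norm (u t))\<^sup>2"
        using \<open>\<sigma> > 0\<close> that by (intro mult_mono le) (auto intro: power_le_one)
      then show ?thesis by (simp add: power_mult_distrib)
    qed
    then show "AE t in lborel. norm ((damped u \<sigma> i t)\<^sup>2) \<le> norm (indicator {0..} t *\<^sub>R (norm (u t))\<^sup>2)"
      by (auto simp: damped_def indicator_def)
  qed simp
qed

text \<open>The inner product of the signals weighted by exp(-2\<sigma> t), split into components to
  fit the scalar Parseval identity.\<close>

definition damped_inner :: "(real \<Rightarrow> real ^ 'n::finite) \<Rightarrow> (real \<Rightarrow> real ^ 'n) \<Rightarrow> real \<Rightarrow> real" where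
  "damped_inner u y \<sigma> = (\<Sum>i\<in>UNIV. LINT t|lborel. damped u \<sigma> i t * damped y \<sigma> i t)"

lemma parseval_laplace:
  assumes u: "u \<in> L2" and y: "y \<in> L2" and \<sigma>: "\<sigma> > 0"
  shows parseval_laplace_integrable: "integrable lborel (\<lambda>\<omega>. laplace u (Complex \<sigma> \<omega>) \<bullet> laplace y (Complex \<sigma> \<omega>))"
    and parseval_laplace_eq: "(LINT \<omega>|lborel. laplace u (Complex \<sigma> \<omega>) \<bullet> laplace y (Complex \<sigma> \<omega>)) = 2 * pi * damped_inner u y \<sigma>"
proof -
  note P = parseval[OF damped_integrable[OF u \<sigma>] damped_integrable[OF y \<sigma>]]
  show "integrable lborel (\<lambda>\<omega>. laplace u (Complex \<sigma> \<omega>) \<bullet> laplace y (Complex \<sigma> \<omega>))"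
    unfolding inner_vec_def laplace_eq_fourier by (intro Bochner_Integration.integrable_sum P)
  show "(LINT \<omega>|lborel. laplace u (Complex \<sigma> \<omega>) \<bullet> laplace y (Complex \<sigma> \<omega>)) = 2 * pi * damped_inner u y \<sigma>"
    unfolding inner_vec_def laplace_eq_fourier damped_inner_def
    by (subst Bochner_Integration.integral_sum) (auto simp: P sum_distrib_left)
qed

text \<open>The weight lies in [0, 1] on the half-line and tends to 1, so the absolute value of the
  undamped integrand dominates.\<close>

lemma damped_inner_tendsto:
  assumes u: "u \<in> L2" and y: "y \<in> L2" and e: "\<And>n. e n > 0" "e \<longlonglongrightarrow> 0"
  shows "(\<lambda>n. damped_inner u y (e n)) \<longlonglongrightarrow> l2_inner u y"
proof -
  let ?f = "\<lambda>t. indicator {0..} t *\<^sub>R (u t \<bullet> y t)"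
  have I: "integrable lborel ?f"
    using L2_integrable_inner[OF u y] by (simp add: set_integrable_def)
  have prod: "integrable lborel (\<lambda>t. damped u (e n) i t * damped y (e n) i t)" for n i
  proof (rule Bochner_Integration.integrable_bound)
    show "integrable lborel (\<lambda>t. (damped u (e n) i t)\<^sup>2 + (damped y (e n) i t)\<^sup>2)"
      using damped_integrable(2)[OF u e(1)] damped_integrable(2)[OF y e(1)] by auto
    show "AE t in lborel. norm (damped u (e n) i t * damped y (e n) i t) \<le>
        norm ((damped u (e n) i t)\<^sup>2 + (damped y (e n) i t)\<^sup>2)"
      using abs_mult_le_sum_squares by simp
    show "(\<lambda>t. damped u (e n) i t * damped y (e n) i t) \<in> borel_measurable lborel"
      using damped_integrable(1)[OF u e(1)] damped_integrable(1)[OF y e(1)]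
      by (intro borel_measurable_times) auto
  qed
  have "damped_inner u y (e n) = (LINT t|lborel. (\<Sum>i\<in>UNIV. damped u (e n) i t * damped y (e n) i t))" for n
    unfolding damped_inner_def by (rule Bochner_Integration.integral_sum[symmetric]) (rule prod)
  also have "(\<lambda>t. \<Sum>i\<in>UNIV. damped u (e n) i t * damped y (e n) i t) = (\<lambda>t. (exp (- (e n * t)))\<^sup>2 * ?f t)" for n
    by (auto simp: fun_eq_iff damped_def inner_vec_def indicator_def sum_distrib_left power2_eq_square intro!: sum.cong)
  finally have eq: "damped_inner u y (e n) = (LINT t|lborel. (exp (- (e n * t)))\<^sup>2 * ?f t)" for n .
  have "(\<lambda>n. LINT t|lborel. (exp (- (e n * t)))\<^sup>2 * ?f t) \<longlonglongrightarrow> integral\<^sup>L lborel ?f"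
  proof (rule integral_dominated_convergence)
    show "integrable lborel (\<lambda>t. norm (?f t))" using I by (rule integrable_norm)
    have [measurable]: "?f \<in> borel_measurable borel" using I by simp
    show "(\<lambda>t. (exp (- (e n * t)))\<^sup>2 * ?f t) \<in> borel_measurable lborel" for n by measurable
    show "AE t in lborel. (\<lambda>n. (exp (- (e n * t)))\<^sup>2 * ?f t) \<longlonglongrightarrow> ?f t"
    proof (rule AE_I2)
      fix t
      have "(\<lambda>n. (exp (- (e n * t)))\<^sup>2 * ?f t) \<longlonglongrightarrow> (exp (- (0 * t)))\<^sup>2 * ?f t"
        by (intro tendsto_intros e)
      then show "(\<lambda>n. (exp (- (e n * t)))\<^sup>2 * ?f t) \<longlonglongrightarrow> ?f t" by simp
    qed
    show "AE t in lborel. norm ((exp (- (e n * t)))\<^sup>2 * ?f t) \<le> norm (?f t)" for n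
    proof (rule AE_I2)
      fix t :: real
      show "norm ((exp (- (e n * t)))\<^sup>2 * ?f t) \<le> norm (?f t)"
      proof (cases "t \<ge> 0")
        case True
        then have "(exp (- (e n * t)))\<^sup>2 \<le> 1" using e(1)[of n] by (intro power_le_one) auto
        then show ?thesis by (simp add: abs_mult mult_left_le_one_le)
      qed simp
    qed
  qed (use I in auto)
  then show ?thesis by (simp add: eq l2_inner_def set_lebesgue_integral_def)
qed

text \<open>The coefficients \<open>b\<close>, \<open>g\<close>, \<open>k\<close> may have any sign.
  On Re s = \<sigma> the pointwise inequality holds up to an error proportional to \<sigma>;
  Parseval turns it into an inequality for damped signals, and \<sigma> tends to 0.\<close>

lemma frequency_inequality:
  fixes H :: "('n::finite) transfer_matrix"
  assumes H: "H \<in> RH_inf" and uy: "lti_response H u y" 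
    and ineq: "\<And>\<omega> x. let A = tf_eval H (\<i> * of_real \<omega>) in
       b * (x \<bullet> (A *v x)) + g * (norm (A *v x))\<^sup>2 + k * (norm x)\<^sup>2 \<le> 0"
  shows "b * l2_inner u y + g * l2_inner y y + k * l2_inner u u \<le> 0"
proof -
  have u: "u \<in> L2" and y: "y \<in> L2"
    and Y: "\<And>s. Re s > 0 \<Longrightarrow> laplace y s = tf_eval H s *v laplace u s"
    using uy by (auto simp: lti_response_def)
  obtain M where M: "\<And>s x. Re s \<ge> 0 \<Longrightarrow> norm (tf_eval H s *v x) \<le> M * norm x"
    by (rule RH_inf_bounded[OF H]) blast
  obtain L where L: "\<And>s t x. Re s \<ge> 0 \<Longrightarrow> Re t \<ge> 0 \<Longrightarrow>
    norm (tf_eval H s *v x - tf_eval H t *v x) \<le> L * norm (s - t) * norm x"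
    by (rule RH_inf_lipschitz[OF H]) blast
  \<comment> \<open>\<open>K\<close> depends neither on \<sigma> nor on the frequency, so the error
    term vanishes in the limit.\<close>
  define K where "K = (\<bar>b\<bar> + 2 * M * \<bar>g\<bar>) * L"
  have damped: "b * damped_inner u y \<sigma> + g * damped_inner y y \<sigma> + k * damped_inner u u \<sigma> \<le> K * \<sigma> * damped_inner u u \<sigma>"
    if \<sigma>: "\<sigma> > 0" for \<sigma>
  proof -
    let ?U = "\<lambda>\<omega>. laplace u (Complex \<sigma> \<omega>)" and ?Y = "\<lambda>\<omega>. laplace y (Complex \<sigma> \<omega>)"
    have pw: "b * (?U \<omega> \<bullet> ?Y \<omega>) + g * (?Y \<omega> \<bullet> ?Y \<omega>) + k * (?U \<omega> \<bullet> ?U \<omega>) \<le> K * \<sigma> * (?U \<omega> \<bullet> ?U \<omega>)" for \<omega>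
    proof -
      have "Complex \<sigma> \<omega> - \<i> * of_real \<omega> = of_real \<sigma>" by (simp add: complex_eq_iff)
      then have "norm (?Y \<omega> - tf_eval H (\<i> * of_real \<omega>) *v ?U \<omega>) \<le> L * \<sigma> * norm (?U \<omega>)"
        using L[of "Complex \<sigma> \<omega>" "\<i> * of_real \<omega>" "?U \<omega>"] \<sigma> by (simp add: Y)
      \<comment> \<open>Here \<open>v\<close> is H(j\<omega>) applied to \<open>?U \<omega>\<close>,
        \<open>w\<close> is \<open>?Y \<omega>\<close>, and d = L \<sigma>.\<close>
      from quadratic_form_perturb[OF ineq[unfolded Let_def, of "?U \<omega>" \<omega>] this, of M] show ?thesis
        using M[of "Complex \<sigma> \<omega>" "?U \<omega>"] M[of "\<i> * of_real \<omega>" "?U \<omega>"] \<sigma>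
        by (simp add: Y K_def mult.assoc power2_norm_eq_inner)
    qed
    have I: "integrable lborel (\<lambda>\<omega>. ?U \<omega> \<bullet> ?Y \<omega>)" "integrable lborel (\<lambda>\<omega>. ?Y \<omega> \<bullet> ?Y \<omega>)"
        "integrable lborel (\<lambda>\<omega>. ?U \<omega> \<bullet> ?U \<omega>)"
      by (intro parseval_laplace_integrable u y \<sigma>)+
    have "(LINT \<omega>|lborel. b * (?U \<omega> \<bullet> ?Y \<omega>) + g * (?Y \<omega> \<bullet> ?Y \<omega>) + k * (?U \<omega> \<bullet> ?U \<omega>)) \<le>
        (LINT \<omega>|lborel. K * \<sigma> * (?U \<omega> \<bullet> ?U \<omega>))"
      by (intro integral_mono pw Bochner_Integration.integrable_add integrable_mult_right I)
    then have "2 * pi * (b * damped_inner u y \<sigma> + g * damped_inner y y \<sigma> + k * damped_inner u u \<sigma>) \<le>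
        2 * pi * (K * \<sigma> * damped_inner u u \<sigma>)"
      using I by (simp add: parseval_laplace_eq u y \<sigma> algebra_simps)
    then show ?thesis by (simp only: mult_le_cancel_left_pos pi_gt_zero zero_less_mult_iff zero_less_numeral simp_thms)
  qed
  define e where "e = (\<lambda>n::nat. inverse (real (Suc n)))"
  have e: "\<And>n. e n > 0" "e \<longlonglongrightarrow> 0"
    unfolding e_def using LIMSEQ_inverse_real_of_nat by auto
  have "(\<lambda>n. b * damped_inner u y (e n) + g * damped_inner y y (e n) + k * damped_inner u u (e n))
      \<longlonglongrightarrow> b * l2_inner u y + g * l2_inner y y + k * l2_inner u u"
    by (intro tendsto_intros damped_inner_tendsto u y e)
  moreover have "(\<lambda>n. K * e n * damped_inner u u (e n)) \<longlonglongrightarrow> K * 0 * l2_inner u u"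
    by (intro tendsto_intros damped_inner_tendsto u y e)
  ultimately have "b * l2_inner u y + g * l2_inner y y + k * l2_inner u u \<le> K * 0 * l2_inner u u"
    by (rule LIMSEQ_le) (use damped e(1) in auto)
  then show ?thesis by simp
qed

section \<open>From inner products of signals to points of the scaled graph\<close>

lemma l2_Cauchy_Schwarz:
  fixes u y :: "real \<Rightarrow> real ^ 'n::finite"
  assumes u: "u \<in> L2" and y: "y \<in> L2"
  shows "\<bar>l2_inner u y\<bar> \<le> l2_norm u * l2_norm y"
proof -
  have pos: "0 \<le> a\<^sup>2 * l2_inner u u - 2 * a * b * l2_inner u y + b\<^sup>2 * l2_inner y y" for a b
  proof -
    have sq: "(a *\<^sub>R v - b *\<^sub>R w) \<bullet> (a *\<^sub>R v - b *\<^sub>R w) =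
        a\<^sup>2 * (v \<bullet> v) - 2 * a * b * (v \<bullet> w) + b\<^sup>2 * (w \<bullet> w)" for v w :: "real ^ 'n"
      by (simp add: inner_diff_left inner_diff_right inner_commute[of w v] power2_eq_square algebra_simps)
    have "0 \<le> (LINT t:{0..}|lborel. (a *\<^sub>R u t - b *\<^sub>R y t) \<bullet> (a *\<^sub>R u t - b *\<^sub>R y t))"
      unfolding set_lebesgue_integral_def by (intro Bochner_Integration.integral_nonneg) simp
    also have "\<dots> = (LINT t:{0..}|lborel. a\<^sup>2 * (u t \<bullet> u t) - 2 * a * b * (u t \<bullet> y t) + b\<^sup>2 * (y t \<bullet> y t))"
      unfolding sq ..
    also have "\<dots> = a\<^sup>2 * l2_inner u u - 2 * a * b * l2_inner u y + b\<^sup>2 * l2_inner y y"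
      using L2_integrable_inner[OF u u] L2_integrable_inner[OF u y] L2_integrable_inner[OF y y]
      by (simp add: l2_inner_def set_integral_add set_integral_diff)
    finally show ?thesis .
  qed
  have "(l2_inner u y)\<^sup>2 \<le> (l2_norm u)\<^sup>2 * (l2_norm y)\<^sup>2"
  proof (cases "l2_inner u u = 0")
    case True
    have "l2_inner u y = 0"
    proof (rule ccontr)
      assume "l2_inner u y \<noteq> 0"
      then show False
        \<comment> \<open>With this choice the nonnegative quadratic form would take the value
          -1.\<close>
        using pos[of "(l2_inner y y + 1) / (2 * l2_inner u y)" 1] True by simp
    qed
    then show ?thesis by simp
  next
    case False
    then have "0 < l2_inner u u" using l2_norm_eq[of u] by (metis less_eq_real_def zero_le_power2)
    \<comment> \<open>The minimising ratio a/b is <u,y> / <u,u>; taking its numerator and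
      denominator as \<open>a\<close> and \<open>b\<close> avoids the division.\<close>
    moreover have "0 \<le> l2_inner u u * (l2_inner u u * l2_inner y y - (l2_inner u y)\<^sup>2)"
      using pos[of "l2_inner u y" "l2_inner u u"] by (simp add: power2_eq_square algebra_simps)
    ultimately show ?thesis by (simp add: l2_norm_eq zero_le_mult_iff)
  qed
  then have "\<bar>l2_inner u y\<bar> \<le> \<bar>l2_norm u * l2_norm y\<bar>"
    by (simp only: power_mult_distrib[symmetric] abs_le_square_iff)
  then show ?thesis by (simp add: l2_norm_nonneg)
qed

text \<open>Conjugate points share real part and modulus, so the sign of the phase does not matter.
  Cauchy-Schwarz puts the argument of \<open>arccos\<close> into [-1, 1], where \<open>cos\<close>
  inverts it.\<close>

lemma scaled_graph_points:
  assumes u: "u \<in> L2" and y: "y \<in> L2" and n: "l2_norm u \<noteq> 0"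
    and z: "z = rcis (gain u y) (phase u y) \<or> z = rcis (gain u y) (- phase u y)"
  shows "Re z = l2_inner u y / l2_inner u u" and "(Re z)\<^sup>2 + (Im z)\<^sup>2 = l2_inner y y / l2_inner u u"
proof -
  have cs: "\<bar>l2_inner u y\<bar> \<le> l2_norm u * l2_norm y" by (rule l2_Cauchy_Schwarz[OF u y])
  have "Re z = gain u y * cos (phase u y)" using z by auto
  also have "\<dots> = l2_inner u y / l2_inner u u"
  proof (cases "l2_norm y = 0")
    case True
    \<comment> \<open>The conventional phase 0 is harmless: the gain is 0, and Cauchy-Schwarz forces
      \<open>l2_inner u y = 0\<close>.\<close>
    then show ?thesis using cs by (simp add: gain_def)
  next
    case False
    then have "0 < l2_norm u * l2_norm y" using n l2_norm_nonneg[of u] l2_norm_nonneg[of y] by simp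
    then have "-1 \<le> l2_inner u y / (l2_norm u * l2_norm y)" "l2_inner u y / (l2_norm u * l2_norm y) \<le> 1"
      using cs by (simp_all add: le_divide_eq divide_le_eq abs_le_iff)
    then have "cos (phase u y) = l2_inner u y / (l2_norm u * l2_norm y)"
      using False by (simp add: phase_def)
    then show ?thesis using False by (simp add: gain_def l2_norm_eq[of u, symmetric] power2_eq_square)
  qed
  finally show "Re z = l2_inner u y / l2_inner u u" .
  have "(Re z)\<^sup>2 + (Im z)\<^sup>2 = (gain u y)\<^sup>2 * ((cos (phase u y))\<^sup>2 + (sin (phase u y))\<^sup>2)"
    using z by (auto simp: power_mult_distrib distrib_left simp del: sin_cos_squared_add sin_cos_squared_add2)
  then show "(Re z)\<^sup>2 + (Im z)\<^sup>2 = l2_inner y y / l2_inner u u"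
    by (simp add: gain_def power_divide l2_norm_eq)
qed

theorem theorem3:
  fixes H :: "('n::finite) transfer_matrix"
    and \<Theta> :: "real ^ 3 ^ 3"
    and \<Theta>\<^sub>1\<^sub>1 \<Theta>\<^sub>2\<^sub>2 \<Theta>\<^sub>1\<^sub>3 \<Theta>\<^sub>3\<^sub>3 \<alpha> :: real
    and H\<^sub>s Q :: "real \<Rightarrow> complex ^ 'n ^ 'n"
  assumes "H \<in> RH_inf"
    and "\<Theta> = vector [vector [\<Theta>\<^sub>1\<^sub>1, 0, \<Theta>\<^sub>1\<^sub>3], vector [0, \<Theta>\<^sub>2\<^sub>2, 0], vector [\<Theta>\<^sub>1\<^sub>3, 0, \<Theta>\<^sub>3\<^sub>3]]"
    and "indefinite \<Theta>"
    and "\<Theta>\<^sub>1\<^sub>1 \<ge> \<Theta>\<^sub>2\<^sub>2"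
    and "\<alpha> = \<Theta>\<^sub>1\<^sub>1 - \<Theta>\<^sub>2\<^sub>2"
    and "\<And>\<omega>. H\<^sub>s \<omega> = hermitian_part (tf_eval H (\<i> * complex_of_real \<omega>))"
    and "\<And>\<omega>. Q \<omega> = \<alpha> *\<^sub>R (H\<^sub>s \<omega> ** H\<^sub>s \<omega>)
          + \<Theta>\<^sub>2\<^sub>2 *\<^sub>R (conj_transpose (tf_eval H (\<i> * complex_of_real \<omega>)) ** tf_eval H (\<i> * complex_of_real \<omega>))
          + (2 * \<Theta>\<^sub>1\<^sub>3) *\<^sub>R H\<^sub>s \<omega> + \<Theta>\<^sub>3\<^sub>3 *\<^sub>R mat 1"
    and "\<And>\<omega>. neg_semidef (Q \<omega>)"
  shows "scaled_graph H \<subseteq> conic_region \<Theta>"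
proof
  fix z assume "z \<in> scaled_graph H"
  then obtain u y where n: "l2_norm u \<noteq> 0" and uy: "lti_response H u y"
    and z: "z = rcis (gain u y) (phase u y) \<or> z = rcis (gain u y) (- phase u y)"
    by (auto simp: scaled_graph_def)
  have u: "u \<in> L2" and y: "y \<in> L2" using uy by (auto simp: lti_response_def)
  \<comment> \<open>\<open>r\<close> is both the real part of \<open>z\<close> and the best tangent
    parameter: it maximises 2 \<alpha> c <u,y> - \<alpha> c^2 |u|^2 over \<open>c\<close>.\<close>
  define r where "r = l2_inner u y / l2_inner u u"
  have "l2_inner u u > 0" using n l2_norm_eq[of u] by (metis zero_less_power2)
  have "\<alpha> \<ge> 0" using assms(4,5) by simp
  have "(2 * \<alpha> * r + 2 * \<Theta>\<^sub>1\<^sub>3) * l2_inner u y + \<Theta>\<^sub>2\<^sub>2 * l2_inner y y + (\<Theta>\<^sub>3\<^sub>3 - \<alpha> * r\<^sup>2) * l2_inner u u \<le> 0"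
  proof (rule frequency_inequality[OF assms(1) uy], unfold Let_def)
    fix \<omega> x
    show "(2 * \<alpha> * r + 2 * \<Theta>\<^sub>1\<^sub>3) * (x \<bullet> (tf_eval H (\<i> * of_real \<omega>) *v x)) +
        \<Theta>\<^sub>2\<^sub>2 * (norm (tf_eval H (\<i> * of_real \<omega>) *v x))\<^sup>2 + (\<Theta>\<^sub>3\<^sub>3 - \<alpha> * r\<^sup>2) * (norm x)\<^sup>2 \<le> 0"
      using assms(8)[of \<omega>] \<open>\<alpha> \<ge> 0\<close> unfolding assms(7) assms(6) by (rule quadratic_form_bound)
  qed
  then have "((2 * \<alpha> * r + 2 * \<Theta>\<^sub>1\<^sub>3) * l2_inner u y + \<Theta>\<^sub>2\<^sub>2 * l2_inner y y + (\<Theta>\<^sub>3\<^sub>3 - \<alpha> * r\<^sup>2) * l2_inner u u) / l2_inner u u \<le> 0"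
    using \<open>l2_inner u u > 0\<close> by (rule divide_nonpos_pos)
  moreover have "((2 * \<alpha> * r + 2 * \<Theta>\<^sub>1\<^sub>3) * l2_inner u y + \<Theta>\<^sub>2\<^sub>2 * l2_inner y y + (\<Theta>\<^sub>3\<^sub>3 - \<alpha> * r\<^sup>2) * l2_inner u u) / l2_inner u u
      = (2 * \<alpha> * r + 2 * \<Theta>\<^sub>1\<^sub>3) * r + \<Theta>\<^sub>2\<^sub>2 * (l2_inner y y / l2_inner u u) + (\<Theta>\<^sub>3\<^sub>3 - \<alpha> * r\<^sup>2)"
    using \<open>l2_inner u u > 0\<close> by (simp add: r_def add_divide_distrib)
  \<comment> \<open>The terms in \<open>r\<close> combine to 2 \<alpha> r^2 - \<alpha> r^2 =
    \<alpha> r^2, and the ratio of squared norms is |z|^2; since \<open>\<alpha> =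
    \<Theta>\<^sub>1\<^sub>1 - \<Theta>\<^sub>2\<^sub>2\<close>, the conic form results.\<close>
  ultimately have "\<Theta>\<^sub>1\<^sub>1 * (Re z)\<^sup>2 + \<Theta>\<^sub>2\<^sub>2 * (Im z)\<^sup>2 + 2 * \<Theta>\<^sub>1\<^sub>3 * Re z + \<Theta>\<^sub>3\<^sub>3 \<le> 0"
    using scaled_graph_points[OF u y n z] unfolding r_def[symmetric] assms(5)
    by (simp flip: scaled_graph_points(2)[OF u y n z] add: power2_eq_square algebra_simps)
  then show "z \<in> conic_region \<Theta>"
    unfolding conic_region_def assms(2)
    by (simp add: inner_vec_def sum_3 matrix_vector_mult_def vector_3 power2_eq_square algebra_simps)
qed

end
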